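(* Let $\mathbb H$ be a finite dimensional Euclidean space, let $\phi\in \mathrm C^1(\mathbb H)$ satisfy the quadratic lower bound $$\exists\,\tau_*>0,\ \phi_*\in\mathbb R:\quad \frac1{2\tau_*}|x|^2+\phi(x)\ge-\phi_*\quad\text{for every }x\in\mathbb H,$$ and let $u:[0,+\infty)\to\mathbb H$ be a ($\mathrm C^1$) solution of $u'(t)=-\nabla\phi(u(t))$, $t\ge0$. Then $u$ is strongly approximable; i.e. there exist functions $\phi_\tau:\mathbb H\to\mathbb R$ ($\tau>0$) such that $\mathrm{Lip}[\phi_\tau-\phi]\to0$ as $\tau\downarrow0$ and $$\mathrm{MM}(\Phi,u(0))=\{u\}=\mathrm{GMM}(\Phi,u(0))\qquad\text{for}\quad \Phi(\tau,U,V):=\phi_\tau(V)+\frac1{2\tau}|V-U|^2 .$$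
   Context: $\mathrm{Lip}[\psi]:=\sup_{x\ne y}\frac{\psi(y)-\psi(x)}{|y-x|}$ for $\psi:\mathbb H\to\mathbb R$. $\mathbb N$ contains $0$. For $\psi:\mathbb H\to\mathbb R$, $\tau>0$, $u_0\in\mathbb H$: $\mathrm{MS}_\tau(\psi;u_0)$ is the (possibly empty) set of sequences $(U^n_\tau)_{n\in\mathbb N}$ with $U^0_\tau=u_0$ and $\frac1{2\tau}|U^n_\tau-U^{n-1}_\tau|^2+\psi(U^n_\tau)\le\frac1{2\tau}|V-U^{n-1}_\tau|^2+\psi(V)$ for every $V\in\mathbb H$ and $n\ge1$. $\mathrm M_\tau(\psi;u_0)$ is the set of discrete solutions, i.e. piecewise constant interpolations $U_\tau:[0,\infty)\to\mathbb H$, $U_\tau(0)=u_0$, $U_\tau(t)=U^n_\tau$ for $t\in((n-1)\tau,n\tau]$, of elements of $\mathrm{MS}_\tau(\psi;u_0)$. For $\Phi(\tau,U,V)=\frac1{2\tau}|V-U|^2+\phi_\tau(V)$: a curve $w:[0,\infty)\to\mathbb H$ belongs to $\mathrm{MM}(\Phi,u_0)$ if there are $U_\tau\in\mathrm M_\tau(\phi_\tau;u_0)$, for all $\tau$ in a right neighborhood of $0$, with $\lim_{\tau\downarrow0}U_\tau(t)=w(t)$ for every $t\ge0$; it belongs to $\mathrm{GMM}(\Phi,u_0)$ if there are a decreasing sequence $\tau(k)\downarrow0$ and $U_{\tau(k)}\in\mathrm M_{\tau(k)}(\phi_{\tau(k)};u_0)$ with $\lim_{k\to\infty}U_{\tau(k)}(t)=w(t)$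 for every $t\ge0$. Let $\mathsf d_\infty(u,v):=\sup_{t\ge0}\frac1{1+t}\big(|u(t)-v(t)|\wedge1\big)$ for $u,v:[0,\infty)\to\mathbb H$, and for a set $\mathcal U$ of such curves $\mathsf D_\infty(v,\mathcal U):=\sup_{u\in\mathcal U}\mathsf d_\infty(v,u)$, with $\mathsf D_\infty(v,\emptyset):=+\infty$. A $\mathrm C^1$ solution $u:[0,\infty)\to\mathbb H$ of $u'=-\nabla\phi(u)$ is strongly approximable if there are $\tau_o>0$ and $\phi_\tau:\mathbb H\to\mathbb R$, $\tau\in(0,\tau_o)$, with $\lim_{\tau\downarrow0}\mathrm{Lip}[\phi_\tau-\phi]=0$ and $\lim_{\tau\downarrow0}\mathsf D_\infty(u,\mathrm M_\tau(\phi_\tau;u(0)))=0$. *)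

theory Defs
  imports "HOL-Analysis.Analysis"
begin

text \<open>
  Curves defined on the half line are functions of type \<open>real \<Rightarrow> 'a\<close>. Sets of curves contain only
  members of \<open>extensional {0..}\<close>, so that equality of curves is equality on the half line; a given
  function \<open>u\<close> is regarded as such a curve through \<open>restrict u {0..}\<close>.
  Families \<open>\<phi>\<tau>\<close> of functions are indexed by all reals, but only small positive indices matter.
\<close>

text \<open>Extended-real valued, since the supremum may be infinite.\<close>

definition Lip :: "('a::euclidean_space \<Rightarrow> real) \<Rightarrow> ereal" where
  "Lip \<psi> = (SUP (x, y) \<in> {(x, y). x \<noteq> y}. ereal ((\<psi> y - \<psi> x) / norm (y - x)))"

definition MS :: "real \<Rightarrow> ('a::euclidean_space \<Rightarrow> real) \<Rightarrow> 'a \<Rightarrow> (nat \<Rightarrow> 'a) set" where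
  "MS \<tau> \<psi> u\<^sub>0 = {U. U 0 = u\<^sub>0 \<and>
     (\<forall>n\<ge>1. \<forall>V. 1 / (2 * \<tau>) * (norm (U n - U (n - 1)))\<^sup>2 + \<psi> (U n)
                 \<le> 1 / (2 * \<tau>) * (norm (V - U (n - 1)))\<^sup>2 + \<psi> V)}"

definition discrete_solutions ::
    "real \<Rightarrow> ('a::euclidean_space \<Rightarrow> real) \<Rightarrow> 'a \<Rightarrow> (real \<Rightarrow> 'a) set" where
  "discrete_solutions \<tau> \<psi> u\<^sub>0 = {w \<in> extensional {0..}. \<exists>U \<in> MS \<tau> \<psi> u\<^sub>0. w 0 = u\<^sub>0 \<and>
     (\<forall>n\<ge>1. \<forall>t \<in> {(real n - 1) * \<tau> <.. real n * \<tau>}. w t = U n)}"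

text \<open>
  The functional \<open>\<Phi>(\<tau>, U, V) = \<bar>V - U\<bar>\<^sup>2 / (2 \<tau>) + \<phi>\<tau> \<tau> V\<close> enters the minimizing movements
  only through the family \<open>\<phi>\<tau>\<close>, which is therefore the parameter of \<open>MM\<close> and \<open>GMM\<close>.
\<close>

definition MM :: "(real \<Rightarrow> 'a::euclidean_space \<Rightarrow> real) \<Rightarrow> 'a \<Rightarrow> (real \<Rightarrow> 'a) set" where
  "MM \<phi>\<tau> u\<^sub>0 = {w \<in> extensional {0..}. \<exists>\<tau>\<^sub>0>0. \<exists>U.
     (\<forall>\<tau> \<in> {0<..<\<tau>\<^sub>0}. U \<tau> \<in> discrete_solutions \<tau> (\<phi>\<tau> \<tau>) u\<^sub>0) \<and>
     (\<forall>t\<ge>0. ((\<lambda>\<tau>. U \<tau> t) \<longlongrightarrow> w t) (at_right 0))}"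

definition GMM :: "(real \<Rightarrow> 'a::euclidean_space \<Rightarrow> real) \<Rightarrow> 'a \<Rightarrow> (real \<Rightarrow> 'a) set" where
  "GMM \<phi>\<tau> u\<^sub>0 = {w \<in> extensional {0..}. \<exists>\<tau> :: nat \<Rightarrow> real. \<exists>U.
     decseq \<tau> \<and> (\<forall>k. \<tau> k > 0) \<and> \<tau> \<longlonglongrightarrow> 0 \<and>
     (\<forall>k. U k \<in> discrete_solutions (\<tau> k) (\<phi>\<tau> (\<tau> k)) u\<^sub>0) \<and>
     (\<forall>t\<ge>0. (\<lambda>k. U k t) \<longlonglongrightarrow> w t)}"

definition d_inf :: "(real \<Rightarrow> 'a::euclidean_space) \<Rightarrow> (real \<Rightarrow> 'a) \<Rightarrow> real" where
  "d_inf u v = (SUP t \<in> {0..}. 1 / (1 + t) * min (norm (u t - v t)) 1)"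

definition D_inf :: "(real \<Rightarrow> 'a::euclidean_space) \<Rightarrow> (real \<Rightarrow> 'a) set \<Rightarrow> ereal" where
  "D_inf v \<U> = (if \<U> = {} then \<infinity> else (SUP u \<in> \<U>. ereal (d_inf v u)))"

text \<open>To be used for solutions \<open>u\<close> of the gradient flow of \<open>\<phi>\<close> on the half line.\<close>

definition strongly_approximable ::
    "('a::euclidean_space \<Rightarrow> real) \<Rightarrow> (real \<Rightarrow> 'a) \<Rightarrow> bool" where
  "strongly_approximable \<phi> u \<longleftrightarrow> (\<exists>\<tau>\<^sub>o>0. \<exists>\<phi>\<tau> :: real \<Rightarrow> 'a \<Rightarrow> real.
     ((\<lambda>\<tau>. Lip (\<lambda>x. \<phi>\<tau> \<tau> x - \<phi> x)) \<longlongrightarrow> 0) (at 0 within {0<..<\<tau>\<^sub>o}) \<and>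
     ((\<lambda>\<tau>. D_inf u (discrete_solutions \<tau> (\<phi>\<tau> \<tau>) (u 0))) \<longlongrightarrow> 0) (at 0 within {0<..<\<tau>\<^sub>o}))"

end

theory Submission
  imports Defs
begin

text \<open>
  A single perturbation \<open>f\<close> of \<open>\<phi>\<close>, the same for all small time steps, suffices for each
  accuracy \<open>L\<close>: \<open>f - \<phi>\<close> is \<open>L\<close>-Lipschitz and the discrete solutions of \<open>f\<close> starting at \<open>u 0\<close> exist
  and stay close to \<open>u\<close> on a long time interval once \<open>\<tau>\<close> is small. Letting \<open>L\<close> tend to \<open>0\<close> slowly with
  \<open>\<tau>\<close> gives the family \<open>\<phi>\<tau>\<close> (\<open>strongly_approximable_diagonal\<close>), and convergence of the discrete
  solutions to \<open>u\<close> in \<open>D_inf\<close> forces \<open>MM\<close> and \<open>GMM\<close> to be \<open>{u}\<close>.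

  The difficulty is that \<open>\<nabla>\<phi>\<close> is only continuous, so the gradient flow may have many
  solutions through a point, and \<open>u\<close> may rest at critical points and leave them again. The
  perturbation has to single out \<open>u\<close>, and since it does not see time it has to encode waiting as
  slow motion along a path without self-intersections.

  \<^item> The path (\<open>polygon_exists\<close>). From \<open>u 0\<close> one jumps to the point \<open>u (t 1)\<close> at which \<open>u\<close> leaves the
  ball of radius \<open>h\<close> for the last time, from there to the last exit from the next ball, and so on. Loops
  of \<open>u\<close> are cut off in this way: consecutive points have distance \<open>h\<close> and all others at least \<open>h\<close>
  (\<open>last_exit_chain\<close>). The polygon \<open>w\<close> through these points, run with constant speed on every
  interval \<open>[t k, t (Suc k)]\<close>, is therefore injective, with an estimate that does not depend on \<open>h\<close>
  (\<open>segments_apart\<close>). Because \<open>u\<close> dissipates energy, \<open>\<bar>u r - u s\<bar>\<^sup>2 \<le> (r - s) (\<phi> (u s) - \<phi> (u r))\<close>,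
  the loops cut off are small, so \<open>w\<close> is uniformly close to \<open>u\<close>, and the velocity of \<open>w\<close>, being the mean
  of \<open>-\<nabla>\<phi>(u)\<close> over each interval, is close to \<open>-\<nabla>\<phi>(w)\<close>.

  \<^item> The perturbation. A gradient flow that runs along \<open>w\<close> needs an energy \<open>b\<close> with
  \<open>b' = -\<bar>w'\<bar>\<^sup>2\<close> along \<open>w\<close>. The difference \<open>b - \<phi> \<circ> w\<close> turns out to be Lipschitz with respect to the
  distance of points in space (not only along the path), with a small constant. It is extended from the
  polygon to the whole space with slope \<open>L\<close>, four times larger than its constant on the polygon.

  \<^item> The dynamics. The excess slope makes the polygon attractive: a minimizer of one step that starts
  on the polygon lies on the polygon again (\<open>step_lands_on_path\<close>). On an edge the energy is linear and
  the step therefore advances by exactly \<open>\<tau>\<close> in the time parameter of \<open>w\<close>; only a step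
  over a vertex can deviate, and there are finitely many of those (\<open>discrete_solutions_follow_path\<close>).
\<close>

section \<open>Convergence of discrete solutions in the supremum distance\<close>

lemma min_norm_le_d_inf:
  fixes u v :: "real \<Rightarrow> 'a::euclidean_space"
  assumes "t \<ge> 0"
  shows "min (norm (u t - v t)) 1 \<le> (1 + t) * d_inf u v"
proof -
  have "bdd_above ((\<lambda>t. 1 / (1 + t) * min (norm (u t - v t)) 1) ` {0..})"
  proof (rule bdd_aboveI2)
    fix s :: real assume "s \<in> {0..}"
    then have "1 / (1 + s) * min (norm (u s - v s)) 1 \<le> 1 * 1"
      by (intro mult_mono) (auto simp: divide_simps)
    then show "1 / (1 + s) * min (norm (u s - v s)) 1 \<le> 1" by simp
  qed
  then have "1 / (1 + t) * min (norm (u t - v t)) 1 \<le> d_inf u v"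
    unfolding d_inf_def by (rule cSUP_upper2[where x=t]) (use assms in auto)
  then show ?thesis using assms by (simp add: field_simps)
qed

lemma d_inf_le:
  fixes u v :: "real \<Rightarrow> 'a::euclidean_space"
  assumes near: "\<And>t. 0 \<le> t \<Longrightarrow> t \<le> T \<Longrightarrow> norm (u t - v t) \<le> e"
    and T: "T > 0" "1 / T \<le> e"
  shows "d_inf u v \<le> e"
  unfolding d_inf_def
proof (rule cSUP_least)
  fix t :: real assume t: "t \<in> {0..}"
  have e: "e > 0" using T by (meson divide_pos_pos less_le_trans zero_less_one)
  show "1 / (1 + t) * min (norm (u t - v t)) 1 \<le> e"
  proof (cases "t \<le> T")
    case True
    have "1 / (1 + t) * min (norm (u t - v t)) 1 \<le> 1 * e"
      using t near[of t] True by (intro mult_mono) (auto simp: divide_simps min_def)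
    then show ?thesis by simp
  next
    case False
    have "1 / (1 + t) * min (norm (u t - v t)) 1 \<le> 1 / (1 + t) * 1"
      using t by (intro mult_left_mono) auto
    also have "\<dots> \<le> 1 / T" using False T by (simp add: frac_le)
    finally show ?thesis using T by simp
  qed
qed auto

lemma norm_le_of_min:
  assumes "min (norm x) 1 \<le> e" "e < 1"
  shows "norm x \<le> e"
  using assms by (auto simp: min_def split: if_splits)

lemma tendsto_of_d_inf:
  fixes u :: "real \<Rightarrow> 'a::euclidean_space"
  assumes "((\<lambda>x. d_inf u (U x)) \<longlongrightarrow> 0) F" "t \<ge> 0"
  shows "((\<lambda>x. U x t) \<longlongrightarrow> u t) F"
proof -
  have "((\<lambda>x. (1 + t) * d_inf u (U x)) \<longlongrightarrow> (1 + t) * 0) F"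
    using assms(1) by (intro tendsto_intros)
  then have lim: "((\<lambda>x. (1 + t) * d_inf u (U x)) \<longlongrightarrow> 0) F" by simp
  have "eventually (\<lambda>x. (1 + t) * d_inf u (U x) < 1) F"
    using order_tendstoD(2)[OF lim, of 1] by simp
  then have "eventually (\<lambda>x. norm (U x t - u t) \<le> (1 + t) * d_inf u (U x)) F"
    by eventually_elim
      (metis norm_le_of_min min_norm_le_d_inf[OF \<open>t \<ge> 0\<close>] norm_minus_commute)
  then have "((\<lambda>x. U x t - u t) \<longlongrightarrow> 0) F"
    using lim by (rule Lim_null_comparison)
  then show ?thesis by (simp add: LIM_zero_iff)
qed

lemma D_inf_le:
  assumes "A \<noteq> {}" "\<And>U. U \<in> A \<Longrightarrow> d_inf u U \<le> e"
  shows "D_inf u A \<le> ereal e"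
  using assms unfolding D_inf_def by (auto intro!: SUP_least)

lemma d_inf_nonneg: "d_inf u v \<ge> 0"
proof -
  have "0 \<le> min (norm (u 0 - v 0)) 1" by simp
  also have "\<dots> \<le> (1 + 0) * d_inf u v" by (rule min_norm_le_d_inf) simp
  finally show ?thesis by simp
qed

lemma D_inf_nonneg: "D_inf u A \<ge> 0"
proof (cases "A = {}")
  case False
  then obtain U where U: "U \<in> A" by auto
  have "0 \<le> d_inf u U" by (rule d_inf_nonneg)
  then show ?thesis using U False unfolding D_inf_def
    by (auto intro!: SUP_upper2[of U])
qed (simp add: D_inf_def)

lemma d_inf_tendsto_of_D_inf:
  fixes u :: "real \<Rightarrow> 'a::euclidean_space"
  assumes lim: "((\<lambda>x. D_inf u (A x)) \<longlongrightarrow> 0) F" and mem: "eventually (\<lambda>x. U x \<in> A x) F"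
  shows "((\<lambda>x. d_inf u (U x)) \<longlongrightarrow> 0) F"
proof -
  have "eventually (\<lambda>x. ereal (d_inf u (U x)) \<le> D_inf u (A x)) F"
    using mem by eventually_elim (auto simp: D_inf_def intro!: SUP_upper)
  then have "((\<lambda>x. ereal (d_inf u (U x))) \<longlongrightarrow> 0) F"
    by (intro tendsto_sandwich[OF _ _ tendsto_const lim]) (auto simp: d_inf_nonneg)
  then show ?thesis by (simp add: zero_ereal_def)
qed

lemma D_inf_eventually_nonempty:
  assumes "((\<lambda>x. D_inf u (A x)) \<longlongrightarrow> 0) F"
  shows "eventually (\<lambda>x. A x \<noteq> {}) F"
proof -
  have "eventually (\<lambda>x. D_inf u (A x) < 1) F"
    using order_tendstoD(2)[OF assms, of 1] by simp
  then show ?thesis by eventually_elim (auto simp: D_inf_def)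
qed

text \<open>All discrete solutions, whichever of them is selected, converge to \<open>u\<close>; this gives both the
  uniqueness of the limit and, as \<open>D_inf\<close> of the empty set is infinite, its existence.\<close>

lemma MM_of_D_inf:
  fixes u :: "real \<Rightarrow> 'a::euclidean_space"
  assumes lim: "((\<lambda>\<tau>. D_inf u (discrete_solutions \<tau> (f \<tau>) (u 0))) \<longlongrightarrow> 0) (at_right 0)"
  shows "MM f (u 0) = {restrict u {0..}}"
proof (intro equalityI subsetI)
  fix w assume "w \<in> MM f (u 0)"
  then obtain \<tau>\<^sub>0 U where w: "w \<in> extensional {0..}" "\<tau>\<^sub>0 > 0"
    and U: "\<forall>\<tau> \<in> {0<..<\<tau>\<^sub>0}. U \<tau> \<in> discrete_solutions \<tau> (f \<tau>) (u 0)"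
    and wlim: "\<forall>t\<ge>0. ((\<lambda>\<tau>. U \<tau> t) \<longlongrightarrow> w t) (at_right 0)"
    unfolding MM_def by blast
  have "eventually (\<lambda>\<tau>. U \<tau> \<in> discrete_solutions \<tau> (f \<tau>) (u 0)) (at_right 0)"
    using eventually_at_right_real[OF w(2)] by eventually_elim (use U in blast)
  note close = d_inf_tendsto_of_D_inf[OF lim this]
  have "w t = u t" if "t \<ge> 0" for t
    using tendsto_unique[OF trivial_limit_at_right_real _ tendsto_of_d_inf[OF close that]] wlim that
    by blast
  then show "w \<in> {restrict u {0..}}"
    using w(1) by (auto intro!: extensionalityI[of _ "{0..}"])
next
  fix w assume "w \<in> {restrict u {0..}}"
  then have w: "w = restrict u {0..}" by simp
  define U where "U \<tau> = (SOME v. v \<in> discrete_solutions \<tau> (f \<tau>) (u 0))" for \<tau>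
  have ev: "eventually (\<lambda>\<tau>. U \<tau> \<in> discrete_solutions \<tau> (f \<tau>) (u 0)) (at_right 0)"
    using D_inf_eventually_nonempty[OF lim]
    by eventually_elim (auto simp: U_def some_in_eq)
  then obtain \<tau>\<^sub>0 where "\<tau>\<^sub>0 > 0" "\<forall>\<tau>>0. \<tau> < \<tau>\<^sub>0 \<longrightarrow> U \<tau> \<in> discrete_solutions \<tau> (f \<tau>) (u 0)"
    unfolding eventually_at_right_field by blast
  moreover have "\<forall>t\<ge>0. ((\<lambda>\<tau>. U \<tau> t) \<longlongrightarrow> w t) (at_right 0)"
    unfolding w using tendsto_of_d_inf[OF d_inf_tendsto_of_D_inf[OF lim ev]] by simp
  ultimately show "w \<in> MM f (u 0)"
    unfolding MM_def w by (auto intro!: exI[of _ \<tau>\<^sub>0] exI[of _ U])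
qed

lemma GMM_of_D_inf:
  fixes u :: "real \<Rightarrow> 'a::euclidean_space"
  assumes lim: "((\<lambda>\<tau>. D_inf u (discrete_solutions \<tau> (f \<tau>) (u 0))) \<longlongrightarrow> 0) (at_right 0)"
  shows "GMM f (u 0) = {restrict u {0..}}"
proof (intro equalityI subsetI)
  fix w assume "w \<in> GMM f (u 0)"
  then obtain \<sigma> :: "nat \<Rightarrow> real" and U where w: "w \<in> extensional {0..}"
    and s: "\<forall>k. \<sigma> k > 0" "\<sigma> \<longlonglongrightarrow> 0"
    and U: "\<forall>k. U k \<in> discrete_solutions (\<sigma> k) (f (\<sigma> k)) (u 0)"
    and wlim: "\<forall>t\<ge>0. (\<lambda>k. U k t) \<longlonglongrightarrow> w t"
    unfolding GMM_def by blast
  have "filterlim \<sigma> (at_right 0) sequentially"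
    using s by (auto simp: filterlim_at less_imp_neq[symmetric])
  from filterlim_compose[OF lim this]
  have "(\<lambda>k. d_inf u (U k)) \<longlonglongrightarrow> 0"
    by (rule d_inf_tendsto_of_D_inf) (use U in simp)
  then have "(\<lambda>k. U k t) \<longlonglongrightarrow> u t" if "t \<ge> 0" for t
    using that by (rule tendsto_of_d_inf)
  then have "w t = u t" if "t \<ge> 0" for t
    using wlim that LIMSEQ_unique by blast
  then show "w \<in> {restrict u {0..}}"
    using w(1) by (auto intro!: extensionalityI[of _ "{0..}"])
next
  fix w assume "w \<in> {restrict u {0..}}"
  then have "w \<in> MM f (u 0)" using MM_of_D_inf[OF lim] by simp
  then obtain \<tau>\<^sub>0 U where w: "w \<in> extensional {0..}" "\<tau>\<^sub>0 > 0"
    and U: "\<forall>\<tau> \<in> {0<..<\<tau>\<^sub>0}. U \<tau> \<in> discrete_solutions \<tau> (f \<tau>) (u 0)"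
    and wlim: "\<forall>t\<ge>0. ((\<lambda>\<tau>. U \<tau> t) \<longlongrightarrow> w t) (at_right 0)"
    unfolding MM_def by blast
  define \<sigma> where "\<sigma> k = \<tau>\<^sub>0 / (real k + 2)" for k
  have pos: "0 < \<sigma> k" "\<sigma> k < \<tau>\<^sub>0" for k
    using w(2) by (auto simp: \<sigma>_def field_simps intro: add_pos_nonneg)
  have dec: "decseq \<sigma>" using w(2) by (auto simp: decseq_def \<sigma>_def intro!: divide_left_mono)
  have "(\<lambda>k. \<tau>\<^sub>0 * (1 / real (k + 2))) \<longlonglongrightarrow> \<tau>\<^sub>0 * 0"
    by (intro tendsto_mult tendsto_const LIMSEQ_ignore_initial_segment lim_1_over_n)
  then have s0: "\<sigma> \<longlonglongrightarrow> 0" by (simp add: \<sigma>_def[abs_def] add.commute)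
  have "filterlim \<sigma> (at_right 0) sequentially"
    using s0 pos(1) by (auto simp: filterlim_at less_imp_neq[symmetric])
  then have "\<forall>t\<ge>0. (\<lambda>k. U (\<sigma> k) t) \<longlonglongrightarrow> w t"
    using wlim filterlim_compose by blast
  then show "w \<in> GMM f (u 0)"
    using w(1) pos dec s0 U unfolding GMM_def
    by (auto intro!: exI[of _ \<sigma>] exI[of _ "\<lambda>k. U (\<sigma> k)"])
qed

section \<open>Diagonal choice of the perturbation\<close>

lemma Lip_le:
  assumes "\<And>x y. \<psi> y - \<psi> x \<le> e * norm (y - x)"
  shows "Lip \<psi> \<le> ereal e"
  unfolding Lip_def using assms by (auto intro!: SUP_least simp: divide_simps)

lemma Lip_nonneg: "Lip (\<psi> :: 'a::euclidean_space \<Rightarrow> real) \<ge> 0"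
proof -
  obtain e :: 'a where e: "e \<in> Basis" using nonempty_Basis by blast
  define q where "q x y = ereal ((\<psi> y - \<psi> x) / norm (y - x))" for x y
  have "q x y \<le> Lip \<psi>" if "x \<noteq> y" for x y
    unfolding Lip_def q_def using that by (intro SUP_upper2[of "(x, y)"]) auto
  moreover have "e \<noteq> 0" using e by auto
  ultimately have "q 0 e \<le> Lip \<psi>" "q e 0 \<le> Lip \<psi>" by auto
  moreover have "0 \<le> q 0 e \<or> 0 \<le> q e 0"
    by (auto simp: q_def zero_le_divide_iff)
  ultimately show ?thesis by (meson order_trans)
qed

lemma tendsto_0_of_eventually_le_inverse:
  fixes g :: "'b \<Rightarrow> ereal"
  assumes "filterlim N sequentially F" "eventually (\<lambda>x. g x \<le> ereal (1 / real (Suc (N x)))) F"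
    "\<And>x. 0 \<le> g x"
  shows "(g \<longlongrightarrow> 0) F"
proof -
  have "((\<lambda>x. 1 / real (Suc (N x))) \<longlongrightarrow> 0) F"
    using filterlim_compose[OF LIMSEQ_Suc[OF lim_1_over_n] assms(1)] by simp
  then have "((\<lambda>x. ereal (1 / real (Suc (N x)))) \<longlongrightarrow> 0) F"
    by (simp add: zero_ereal_def)
  from tendsto_sandwich[OF always_eventually assms(2) tendsto_const this]
  show ?thesis using assms(3) by blast
qed

text \<open>The bound \<open>n \<le> 1 / \<tau>\<close> keeps the set of admissible \<open>n\<close> finite; its largest element still
  tends to infinity because every fixed \<open>n\<close> is eventually admissible.\<close>

lemma diagonal_at_right:
  fixes Q :: "nat \<Rightarrow> real \<Rightarrow> bool"
  assumes ev: "\<And>n. eventually (Q n) (at_right 0)"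
  shows "\<exists>N. filterlim N sequentially (at_right 0) \<and> eventually (\<lambda>\<tau>. Q (N \<tau>) \<tau>) (at_right 0)"
proof -
  define S where "S \<tau> = {n. real n \<le> 1 / \<tau> \<and> Q n \<tau>}" for \<tau>
  define N where "N \<tau> = Max (S \<tau>)" for \<tau>
  have fin: "finite (S \<tau>)" for \<tau>
    by (rule finite_subset[of _ "{..nat \<lfloor>1 / \<tau>\<rfloor>}"]) (auto simp: S_def le_nat_floor)
  have inS: "eventually (\<lambda>\<tau>. n \<in> S \<tau>) (at_right 0)" for n
  proof -
    have "eventually (\<lambda>\<tau>. \<tau> \<in> {0<..<1 / (real n + 1)}) (at_right 0)"
      by (rule eventually_at_right_real) simp
    then show ?thesis using ev[of n]
    proof eventually_elim
      case (elim \<tau>)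
      then have "real n * \<tau> \<le> 1" by (auto simp: field_simps)
      then show ?case using elim by (auto simp: S_def field_simps)
    qed
  qed
  have "filterlim N sequentially (at_right 0)"
    unfolding filterlim_at_top
  proof
    fix n show "eventually (\<lambda>\<tau>. n \<le> N \<tau>) (at_right 0)"
      using inS[of n] by eventually_elim (auto simp: N_def intro!: Max_ge fin)
  qed
  moreover have "eventually (\<lambda>\<tau>. Q (N \<tau>) \<tau>) (at_right 0)"
    using inS[of 0]
  proof eventually_elim
    case (elim \<tau>)
    have "N \<tau> \<in> S \<tau>" unfolding N_def by (rule Max_in) (use elim fin in auto)
    then show ?case by (simp add: S_def)
  qed
  ultimately show ?thesis by blast
qed

text \<open>It is enough to find, for each accuracy, one perturbation that works for all small \<open>\<tau>\<close>.\<close>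

theorem strongly_approximable_diagonal:
  fixes \<phi> :: "'a::euclidean_space \<Rightarrow> real" and u :: "real \<Rightarrow> 'a"
  assumes approx: "\<And>e. e > 0 \<Longrightarrow> \<exists>f. (\<forall>x y. (f y - \<phi> y) - (f x - \<phi> x) \<le> e * norm (y - x)) \<and>
      eventually (\<lambda>\<tau>. D_inf u (discrete_solutions \<tau> f (u 0)) \<le> ereal e) (at_right 0)"
  shows "\<exists>\<phi>\<tau>. ((\<lambda>\<tau>. Lip (\<lambda>x. \<phi>\<tau> \<tau> x - \<phi> x)) \<longlongrightarrow> 0) (at_right 0) \<and>
    ((\<lambda>\<tau>. D_inf u (discrete_solutions \<tau> (\<phi>\<tau> \<tau>) (u 0))) \<longlongrightarrow> 0) (at_right 0)"
proof -
  define e where "e n = 1 / real (Suc n)" for n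
  have "e n > 0" for n by (simp add: e_def)
  then have "\<exists>f. \<forall>n. (\<forall>x y. (f n y - \<phi> y) - (f n x - \<phi> x) \<le> e n * norm (y - x)) \<and>
      eventually (\<lambda>\<tau>. D_inf u (discrete_solutions \<tau> (f n) (u 0)) \<le> ereal (e n)) (at_right 0)"
    by (intro choice allI approx)
  then obtain f where f: "\<And>n x y. (f n y - \<phi> y) - (f n x - \<phi> x) \<le> e n * norm (y - x)"
      "\<And>n. eventually (\<lambda>\<tau>. D_inf u (discrete_solutions \<tau> (f n) (u 0)) \<le> ereal (e n)) (at_right 0)"
    by blast
  obtain N where "filterlim N sequentially (at_right 0) \<and>
      eventually (\<lambda>\<tau>. D_inf u (discrete_solutions \<tau> (f (N \<tau>)) (u 0)) \<le> ereal (e (N \<tau>))) (at_right 0)"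
    using diagonal_at_right[where Q = "\<lambda>n \<tau>. D_inf u (discrete_solutions \<tau> (f n) (u 0)) \<le> ereal (e n)", OF f(2)] ..
  then have N: "filterlim N sequentially (at_right 0)"
      "eventually (\<lambda>\<tau>. D_inf u (discrete_solutions \<tau> (f (N \<tau>)) (u 0)) \<le> ereal (e (N \<tau>))) (at_right 0)"
    by auto
  have "Lip (\<lambda>x. f n x - \<phi> x) \<le> ereal (e n)" for n
    by (rule Lip_le) (rule f(1))
  then have "((\<lambda>\<tau>. Lip (\<lambda>x. f (N \<tau>) x - \<phi> x)) \<longlongrightarrow> 0) (at_right 0)"
    by (intro tendsto_0_of_eventually_le_inverse[unfolded e_def[symmetric], OF N(1)]
        always_eventually allI Lip_nonneg)
  moreover have "((\<lambda>\<tau>. D_inf u (discrete_solutions \<tau> (f (N \<tau>)) (u 0))) \<longlongrightarrow> 0) (at_right 0)"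
    using N by (rule tendsto_0_of_eventually_le_inverse[unfolded e_def[symmetric]]) (rule D_inf_nonneg)
  ultimately show ?thesis by (intro exI[of _ "\<lambda>\<tau>. f (N \<tau>)"]) simp
qed

section \<open>Polygonal paths\<close>

text \<open>The transfer principle for everything that is known edge by edge: a relation between times
  that can be concatenated holds between all times once it holds within each interval of the partition.\<close>

lemma partition_induct:
  fixes t :: "nat \<Rightarrow> real"
  assumes edge: "\<And>k r s. k < K \<Longrightarrow> t k \<le> r \<Longrightarrow> r < s \<Longrightarrow> s \<le> t (Suc k) \<Longrightarrow> R r s"
    and trans: "\<And>r s q. R r s \<Longrightarrow> R s q \<Longrightarrow> r < s \<Longrightarrow> s < q \<Longrightarrow> R r q"
    and "t 0 \<le> r" "r < s" "s \<le> t K"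
  shows "R r s"
proof -
  have "s \<le> t j \<Longrightarrow> r < s \<Longrightarrow> R r s" if "j \<le> K" for j s
    using that
  proof (induction j arbitrary: s)
    case 0 then show ?case using \<open>t 0 \<le> r\<close> by auto
  next
    case (Suc j)
    consider "s \<le> t j" | "t j \<le> r" | "r < t j" "t j < s" by linarith
    then show ?case
    proof cases
      case 1 then show ?thesis using Suc.IH[of s] Suc.prems by simp
    next
      case 2 then show ?thesis using edge[of j r s] Suc.prems by simp
    next
      case 3
      have "R r (t j)" by (rule Suc.IH) (use 3 Suc.prems in simp_all)
      moreover have "R (t j) s" by (rule edge) (use 3 Suc.prems in simp_all)
      ultimately show ?thesis using 3 by (rule trans)
    qed
  qed
  from this[of K s] show ?thesis using assms(4,5) by simp
qed

text \<open>The function \<open>b\<close> is the energy that the path should have in order to be a gradient flow: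
  it decreases at the rate \<open>\<bar>w'\<bar>\<^sup>2\<close>. The partition has \<open>K\<close> edges, and \<open>K = 0\<close> describes a path at rest.\<close>

locale polygonal_path =
  fixes t :: "nat \<Rightarrow> real" and K :: nat and w :: "real \<Rightarrow> 'a::euclidean_space"
    and b :: "real \<Rightarrow> real" and v :: "nat \<Rightarrow> 'a"
  assumes t_0: "t 0 = 0"
    and t_less: "\<And>k. k < K \<Longrightarrow> t k < t (Suc k)"
    and w_edge: "\<And>k r. k < K \<Longrightarrow> t k \<le> r \<Longrightarrow> r \<le> t (Suc k) \<Longrightarrow> w r = w (t k) + (r - t k) *\<^sub>R v k"
    and b_edge: "\<And>k r. k < K \<Longrightarrow> t k \<le> r \<Longrightarrow> r \<le> t (Suc k) \<Longrightarrow> b r = b (t k) - (r - t k) * (norm (v k))\<^sup>2"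
    and v_nonzero: "\<And>k. k < K \<Longrightarrow> v k \<noteq> 0"
    and w_inj: "inj_on w {0..t K}"
begin

lemma t_mono: "i \<le> j \<Longrightarrow> j \<le> K \<Longrightarrow> t i \<le> t j"
proof (induction j rule: dec_induct)
  case (step n) then show ?case using t_less[of n] by auto
qed simp

lemma t_K_nonneg: "0 \<le> t K" using t_mono[of 0 K] t_0 by simp

lemma w_diff:
  assumes "k < K" "t k \<le> r" "r \<le> t (Suc k)" "t k \<le> s" "s \<le> t (Suc k)"
  shows "w s - w r = (s - r) *\<^sub>R v k"
  using assms by (simp add: w_edge[of k r] w_edge[of k s] flip: scaleR_diff_left)

lemma b_diff:
  assumes "k < K" "t k \<le> r" "r \<le> t (Suc k)" "t k \<le> s" "s \<le> t (Suc k)"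
  shows "b s - b r = - (s - r) * (norm (v k))\<^sup>2"
  using assms by (simp add: b_edge[of k r] b_edge[of k s] algebra_simps)

lemma b_decreasing:
  assumes "0 \<le> r" "r < s" "s \<le> t K"
  shows "b s < b r"
proof (rule partition_induct[of K t "\<lambda>r s. b s < b r"])
  fix k r s assume "k < K" "t k \<le> r" "r < s" "s \<le> t (Suc k)"
  then have "b s - b r = - (s - r) * (norm (v k))\<^sup>2" "(s - r) * (norm (v k))\<^sup>2 > 0"
    using b_diff[of k r s] v_nonzero[of k] by auto
  then show "b s < b r" by (simp add: algebra_simps)
qed (use assms t_0 in auto)

lemma edge_exists:
  assumes "0 \<le> r" "r < t K"
  obtains k where "k < K" "t k \<le> r" "r < t (Suc k)"
proof -
  have "\<exists>k<j. t k \<le> r \<and> r < t (Suc k)" if "r < t j" "j \<le> K" for j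
    using that
  proof (induction j)
    case 0 then show ?case using assms t_0 by simp
  next
    case (Suc j) then show ?case by (cases "r < t j") (auto intro: less_SucI)
  qed
  then show thesis using assms that by blast
qed

text \<open>Used with \<open>G\<close> close to \<open>\<nabla>\<phi>\<close> near the path: moving along \<open>w\<close> for time \<open>\<tau>\<close>
  almost satisfies the Euler equation of one step, also across vertices.\<close>

lemma slope_bound:
  assumes "0 \<le> r" "r \<le> s" "s \<le> t K"
    and slope: "\<And>k q. k < K \<Longrightarrow> t k \<le> q \<Longrightarrow> q \<le> t (Suc k) \<Longrightarrow> r \<le> q \<Longrightarrow> q \<le> s \<Longrightarrow> norm (v k + G) \<le> \<kappa>"
  shows "norm (w s - w r + (s - r) *\<^sub>R G) \<le> \<kappa> * (s - r)"
proof (cases "r = s")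
  case False
  define R where "R p q \<longleftrightarrow> (r \<le> p \<longrightarrow> q \<le> s \<longrightarrow> norm (w q - w p + (q - p) *\<^sub>R G) \<le> \<kappa> * (q - p))" for p q
  have "R r s"
  proof (rule partition_induct[of K t])
    fix k p q assume k: "k < K" "t k \<le> p" "p < q" "q \<le> t (Suc k)"
    show "R p q" unfolding R_def
    proof (intro impI)
      assume "r \<le> p" "q \<le> s"
      then have "norm (v k + G) \<le> \<kappa>" using slope[of k p] k by simp
      moreover have "w q - w p + (q - p) *\<^sub>R G = (q - p) *\<^sub>R (v k + G)"
        using w_diff[of k p q] k by (simp add: algebra_simps)
      ultimately show "norm (w q - w p + (q - p) *\<^sub>R G) \<le> \<kappa> * (q - p)"
        using k by (simp add: mult.commute)
    qed
  next
    fix p q o' assume "R p q" "R q o'" "p < q" "q < o'"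
    show "R p o'" unfolding R_def
    proof (intro impI)
      assume "r \<le> p" "o' \<le> s"
      then have "norm (w q - w p + (q - p) *\<^sub>R G) \<le> \<kappa> * (q - p)"
        "norm (w o' - w q + (o' - q) *\<^sub>R G) \<le> \<kappa> * (o' - q)"
        using \<open>R p q\<close> \<open>R q o'\<close> \<open>p < q\<close> \<open>q < o'\<close> by (auto simp: R_def)
      from norm_add_rule_thm[OF this] show "norm (w o' - w p + (o' - p) *\<^sub>R G) \<le> \<kappa> * (o' - p)"
        by (simp add: algebra_simps)
    qed
  qed (use assms t_0 False in auto)
  then show ?thesis by (simp add: R_def)
qed simp

lemma w_Lipschitz:
  obtains C where "C > 0" "\<And>r s. 0 \<le> r \<Longrightarrow> r \<le> t K \<Longrightarrow> 0 \<le> s \<Longrightarrow> s \<le> t K \<Longrightarrow> norm (w s - w r) \<le> C * \<bar>s - r\<bar>"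
proof
  define C where "C = 1 + (\<Sum>k<K. norm (v k))"
  show "C > 0" unfolding C_def by (intro add_pos_nonneg sum_nonneg) auto
  have "norm (v k) \<le> C" if "k < K" for k
    using member_le_sum[of k "{..<K}" "\<lambda>k. norm (v k)"] that by (auto simp: C_def)
  then have le: "norm (w s - w r) \<le> C * (s - r)" if "0 \<le> r" "r \<le> s" "s \<le> t K" for r s
    using slope_bound[of r s 0 C] that by simp
  show "norm (w s - w r) \<le> C * \<bar>s - r\<bar>" if "0 \<le> r" "r \<le> t K" "0 \<le> s" "s \<le> t K" for r s
    using le[of r s] le[of s r] that by (cases "r \<le> s") (auto simp: norm_minus_commute)
qed

lemma w_continuous: "continuous_on {0..t K} w"
proof -
  obtain C where C: "C > 0" "\<And>r s. 0 \<le> r \<Longrightarrow> r \<le> t K \<Longrightarrow> 0 \<le> s \<Longrightarrow> s \<le> t K \<Longrightarrow> norm (w s - w r) \<le> C * \<bar>s - r\<bar>"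
    using w_Lipschitz by metis
  then have "C-lipschitz_on {0..t K} w"
    by (auto intro!: lipschitz_onI simp: dist_norm)
  then show ?thesis by (rule lipschitz_on_continuous_on)
qed

lemma b_continuous: "continuous_on {0..t K} b"
proof -
  define R where "R p q \<longleftrightarrow> \<bar>b q - b p\<bar> \<le> (\<Sum>k<K. (norm (v k))\<^sup>2) * (q - p)" for p q
  have "R p q" if "0 \<le> p" "p < q" "q \<le> t K" for p q
  proof (rule partition_induct[of K t R])
    fix k p q assume k: "k < K" "t k \<le> p" "p < q" "q \<le> t (Suc k)"
    have "(norm (v k))\<^sup>2 \<le> (\<Sum>k<K. (norm (v k))\<^sup>2)"
      using member_le_sum[of k "{..<K}" "\<lambda>k. (norm (v k))\<^sup>2"] k by auto
    from mult_right_mono[OF this, of "q - p"] show "R p q" unfolding R_def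
      using b_diff[of k p q] k by (simp add: abs_mult mult.commute)
  qed (use that t_0 in \<open>auto simp: R_def algebra_simps\<close>)
  then have le: "\<bar>b q - b p\<bar> \<le> (\<Sum>k<K. (norm (v k))\<^sup>2) * \<bar>q - p\<bar>" if "0 \<le> p" "p \<le> t K" "0 \<le> q" "q \<le> t K" for p q
    using that unfolding R_def by (cases p q rule: linorder_cases) (force simp: abs_minus_commute)+
  then have "(\<Sum>k<K. (norm (v k))\<^sup>2)-lipschitz_on {0..t K} b"
    by (auto intro!: lipschitz_onI sum_nonneg simp: dist_real_def abs_minus_commute)
  then show ?thesis by (rule lipschitz_on_continuous_on)
qed

lemma w_inverse_modulus:
  assumes "\<delta> > 0"
  obtains \<rho> where "\<rho> > 0" "\<And>r s. 0 \<le> r \<Longrightarrow> r \<le> t K \<Longrightarrow> 0 \<le> s \<Longrightarrow> s \<le> t K \<Longrightarrow> norm (w s - w r) < \<rho> \<Longrightarrow> \<bar>s - r\<bar> < \<delta>"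
proof -
  define h where "h = the_inv_into {0..t K} w"
  have "continuous_on (w ` {0..t K}) h"
    unfolding h_def using w_continuous compact_Icc w_inj by (rule continuous_on_inv_into)
  moreover have "compact (w ` {0..t K})"
    using w_continuous compact_Icc by (rule compact_continuous_image)
  ultimately have "uniformly_continuous_on (w ` {0..t K}) h"
    by (rule compact_uniformly_continuous)
  then obtain \<rho> where \<rho>: "\<rho> > 0" "\<And>x y. x \<in> w ` {0..t K} \<Longrightarrow> y \<in> w ` {0..t K} \<Longrightarrow> dist y x < \<rho> \<Longrightarrow> dist (h y) (h x) < \<delta>"
    unfolding uniformly_continuous_on_def using assms by metis
  have "h (w r) = r" if "0 \<le> r" "r \<le> t K" for r
    unfolding h_def using the_inv_into_f_f[OF w_inj] that by simp
  then show thesis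
    using that[OF \<rho>(1)] \<rho>(2)[of "w r" "w s" for r s] by (force simp: dist_norm dist_real_def)
qed

end

section \<open>One step of the scheme\<close>

lemma gradient_bound:
  fixes \<phi> :: "'a::euclidean_space \<Rightarrow> real"
  assumes grad: "\<And>z. GDERIV \<phi> z :> g z" and S: "convex S" "p \<in> S" "q \<in> S"
    and close: "\<And>z. z \<in> S \<Longrightarrow> norm (g z - G) \<le> \<omega>"
  shows "\<bar>\<phi> p - \<phi> q - inner G (p - q)\<bar> \<le> \<omega> * norm (p - q)"
proof -
  have "norm ((\<phi> p - inner p G) - (\<phi> q - inner q G)) \<le> \<omega> * norm (p - q)"
  proof (rule differentiable_bound[OF S(1) _ _ S(2,3)])
    fix z assume z: "z \<in> S"
    have "((\<lambda>z. \<phi> z - inner z G) has_derivative (\<lambda>h. inner h (g z) - inner h G)) (at z within S)"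
      using has_derivative_at_withinI[OF grad[of z, unfolded gderiv_def]]
      by (rule has_derivative_diff) (intro derivative_intros)
    then show "((\<lambda>z. \<phi> z - inner z G) has_derivative (\<lambda>h. inner h (g z - G))) (at z within S)"
      by (simp add: inner_diff_right)
    show "onorm (\<lambda>h. inner h (g z - G)) \<le> \<omega>"
    proof (rule onorm_le)
      fix h show "norm (inner h (g z - G)) \<le> \<omega> * norm h"
        using Cauchy_Schwarz_ineq2[of h "g z - G"] mult_right_mono[OF close[OF z] norm_ge_zero[of h]]
        by (simp add: mult.commute)
    qed
  qed
  then show ?thesis by (simp add: inner_diff_right inner_commute algebra_simps)
qed

text \<open>Let \<open>V\<close> minimize the functional of one step from \<open>x\<close>, and let \<open>y\<close> be the point of the path whose cone
  \<open>a + L \<bar>V - y\<bar>\<close> determines the perturbation at \<open>V\<close>. The point \<open>x'\<close> of the path satisfies the Euler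
  equation of \<open>\<phi>\<close> up to \<open>L / 32\<close>. Comparison with \<open>x'\<close> shows that \<open>V\<close>, hence also \<open>y\<close>, is closer to \<open>x'\<close>
  than \<open>L \<tau>\<close>, because the perturbation varies on the path with a quarter of the slope of the cones only.
  Then \<open>y\<close> satisfies the Euler equation up to an error below \<open>L\<close>, which the cone at \<open>y\<close> absorbs: a minimizer
  different from \<open>y\<close> would be worse than \<open>y\<close>.\<close>

lemma step_lands_on_path:
  fixes \<phi> :: "'a::euclidean_space \<Rightarrow> real"
  assumes L: "L > 0" and \<tau>: "\<tau> > 0"
    and \<phi>: "\<And>p q. norm (p - x') \<le> \<rho> \<Longrightarrow> norm (q - x') \<le> \<rho> \<Longrightarrow>
              \<bar>\<phi> p - \<phi> q - inner G (p - q)\<bar> \<le> L / 64 * norm (p - q)"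
    and x': "norm (x' - x + \<tau> *\<^sub>R G) \<le> L / 32 * \<tau>"
    and V: "norm (V - x') \<le> \<rho> / 2"
    and a: "\<bar>a' - a\<bar> \<le> L / 4 * norm (y - x')"
    and min1: "1 / (2 * \<tau>) * (norm (V - x))\<^sup>2 + \<phi> V + (a + L * norm (V - y))
               \<le> 1 / (2 * \<tau>) * (norm (x' - x))\<^sup>2 + \<phi> x' + a'"
    and min2: "1 / (2 * \<tau>) * (norm (V - x))\<^sup>2 + \<phi> V + (a + L * norm (V - y))
               \<le> 1 / (2 * \<tau>) * (norm (y - x))\<^sup>2 + \<phi> y + a"
  shows "V = y" "norm (V - x') \<le> L * \<tau>"
proof -
  define E d where "E = norm (V - x')" and "d = norm (V - y)"
  have E0: "E \<ge> 0" and d0: "d \<ge> 0" by (simp_all add: E_def d_def)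
  have \<rho>: "\<rho> \<ge> 0" using V norm_ge_zero[of "V - x'"] by linarith
  have yx: "norm (y - x') \<le> E + d"
    unfolding E_def d_def using norm_triangle_ineq4[of "V - x'" "V - y"] by simp
  \<comment> \<open>Both comparisons rest on this expansion of the functional at the competitor \<open>z\<close>.\<close>
  have expand: "(norm (V - x))\<^sup>2 - (norm (z - x))\<^sup>2 = (norm (V - z))\<^sup>2 + 2 * inner (V - z) (z - x)" for z
    by (simp add: power2_norm_eq_inner inner_diff_left inner_diff_right inner_commute algebra_simps)
  have quad: "1 / (2 * \<tau>) * (norm (V - x))\<^sup>2 - 1 / (2 * \<tau>) * (norm (z - x))\<^sup>2 + inner G (V - z)
      = (norm (V - z))\<^sup>2 / (2 * \<tau>) + inner (V - z) (z - x + \<tau> *\<^sub>R G) / \<tau>" for z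
  proof -
    have "inner (V - z) (z - x + \<tau> *\<^sub>R G) = inner (V - z) (z - x) + \<tau> * inner G (V - z)"
      by (simp add: inner_add_right inner_commute)
    then show ?thesis using expand[of z] \<tau> by (simp add: field_simps)
  qed
  have low: "inner (V - z) (z - x + \<tau> *\<^sub>R G) / \<tau> \<ge> - norm (V - z) * \<beta>" 
    if "norm (z - x + \<tau> *\<^sub>R G) \<le> \<beta> * \<tau>" for z \<beta>
  proof -
    have "norm (V - z) * norm (z - x + \<tau> *\<^sub>R G) \<le> norm (V - z) * (\<beta> * \<tau>)"
      using that by (intro mult_left_mono) auto
    then have "- (norm (V - z) * (\<beta> * \<tau>)) \<le> inner (V - z) (z - x + \<tau> *\<^sub>R G)"
      using Cauchy_Schwarz_ineq2[of "V - z" "z - x + \<tau> *\<^sub>R G"] by linarith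
    then show ?thesis using \<tau> by (simp add: field_simps)
  qed
  have "\<phi> V - \<phi> x' \<ge> inner G (V - x') - (L * E) / 64"
  proof -
    have "norm (V - x') \<le> \<rho>" using V \<rho> by linarith
    with \<phi>[of V x'] \<rho> show ?thesis unfolding E_def abs_le_iff by simp
  qed
  moreover have "a - a' \<ge> - ((L * E) / 4 + (L * d) / 4)"
  proof -
    have "\<bar>a' - a\<bar> \<le> L / 4 * (E + d)"
      using a mult_left_mono[OF yx, of "L / 4"] L by linarith
    also have "\<dots> = (L * E) / 4 + (L * d) / 4" by (simp add: algebra_simps)
    finally show ?thesis by linarith
  qed
  moreover have "inner (V - x') (x' - x + \<tau> *\<^sub>R G) / \<tau> \<ge> - ((L * E) / 32)"
    using low[OF x'] by (simp add: E_def mult.commute)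
  ultimately have first: "E\<^sup>2 / (2 * \<tau>) + 3 / 4 * (L * d) \<le> 19 / 64 * (L * E)"
    using min1 quad[of x'] unfolding E_def[symmetric] d_def[symmetric] by linarith
  moreover have Ld0: "L * d \<ge> 0" using L d0 by simp
  ultimately have "E\<^sup>2 / (2 * \<tau>) \<le> 19 / 64 * (L * E)" by linarith
  then have "E * E \<le> (19 / 32 * (L * \<tau>)) * E" using \<tau> by (simp add: field_simps power2_eq_square)
  then have E: "E \<le> 19 / 32 * (L * \<tau>)"
    using E0 L \<tau> by (cases "E = 0") auto
  have "E\<^sup>2 / (2 * \<tau>) \<ge> 0" using \<tau> by simp
  then have "L * d \<le> 19 / 48 * (L * E)" using first Ld0 by linarith
  then have "L * d \<le> L * (19 / 48 * E)" by simp
  then have d: "d \<le> 19 / 48 * E" using L by simp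
  have "L * \<tau> > 0" using L \<tau> by simp
  then show "norm (V - x') \<le> L * \<tau>" using E unfolding E_def by linarith
  show "V = y"
  proof (rule ccontr)
    assume "V \<noteq> y"
    then have dpos: "d > 0" by (simp add: d_def)
    have "norm (y - x') \<le> \<rho>" using yx d V E0 unfolding E_def by linarith
    then have "\<phi> V - \<phi> y \<ge> inner G (V - y) - (L * d) / 64"
      using \<phi>[of V y] V \<rho> unfolding d_def abs_le_iff by simp
    moreover have "norm (y - x + \<tau> *\<^sub>R G) \<le> (7 / 8 * L) * \<tau>"
    proof -
      have "norm (y - x + \<tau> *\<^sub>R G) \<le> norm (y - x') + norm (x' - x + \<tau> *\<^sub>R G)"
        using norm_triangle_ineq[of "y - x'" "x' - x + \<tau> *\<^sub>R G"] by (simp add: algebra_simps)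
      also have "\<dots> \<le> (67 / 48) * (19 / 32 * (L * \<tau>)) + L / 32 * \<tau>"
        using yx d E x' by simp
      also have "\<dots> \<le> (7 / 8 * L) * \<tau>" using L \<tau> by (simp add: field_simps)
      finally show ?thesis .
    qed
    from low[OF this] have "inner (V - y) (y - x + \<tau> *\<^sub>R G) / \<tau> \<ge> - (7 / 8 * (L * d))"
      by (simp add: d_def algebra_simps)
    ultimately have "d\<^sup>2 / (2 * \<tau>) + L * d \<le> 57 / 64 * (L * d)"
      using min2 quad[of y] unfolding d_def[symmetric] by linarith
    moreover have "d\<^sup>2 / (2 * \<tau>) \<ge> 0" using \<tau> by simp
    moreover have "L * d > 0" using L dpos by simp
    ultimately show False by linarith
  qed
qed

section \<open>Existence and localization of minimizers\<close>

lemma sublevel_bound: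
  fixes f :: "'a::euclidean_space \<Rightarrow> real"
  assumes low: "\<And>x. f x \<ge> - A * (norm x)\<^sup>2 - B" and A: "A \<ge> 0"
    and le: "1 / (2 * \<tau>) * (norm (V - x))\<^sup>2 + f V \<le> f x"
  shows "(1 / (2 * \<tau>) - 2 * A) * (norm (V - x))\<^sup>2 \<le> f x + 2 * A * (norm x)\<^sup>2 + B"
proof -
  have "(norm V)\<^sup>2 \<le> (norm (V - x) + norm x)\<^sup>2"
    using norm_triangle_ineq[of "V - x" x] by (intro power_mono) auto
  also have "\<dots> \<le> 2 * (norm (V - x))\<^sup>2 + 2 * (norm x)\<^sup>2"
    using zero_le_power2[of "norm (V - x) - norm x"] by (simp add: power2_sum power2_diff)
  finally have "A * (norm V)\<^sup>2 \<le> A * (2 * (norm (V - x))\<^sup>2 + 2 * (norm x)\<^sup>2)"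
    using A by (rule mult_left_mono)
  then show ?thesis using low[of V] le by (simp add: algebra_simps)
qed

text \<open>As \<open>\<tau>\<close> decreases, the quadratic term beats the quadratic lower bound of \<open>f\<close>; this is what makes
  all estimates near the path local.\<close>

lemma sublevel_localized:
  fixes f :: "'a::euclidean_space \<Rightarrow> real"
  assumes low: "\<And>x. f x \<ge> - A * (norm x)\<^sup>2 - B" and A: "A \<ge> 0" and "\<rho> > 0"
  shows "eventually (\<lambda>\<tau>. \<forall>x V. norm x \<le> R \<longrightarrow> f x \<le> C \<longrightarrow>
    1 / (2 * \<tau>) * (norm (V - x))\<^sup>2 + f V \<le> f x \<longrightarrow> norm (V - x) \<le> \<rho>) (at_right 0)"
proof -
  define D where "D = \<bar>C + 2 * A * R\<^sup>2 + B\<bar>"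
  define c where "c = 2 * A + (D + 1) / \<rho>\<^sup>2"
  have c: "c > 0" using A \<open>\<rho> > 0\<close> by (auto simp: c_def D_def intro!: add_nonneg_pos divide_pos_pos)
  have "eventually (\<lambda>\<tau>::real. \<tau> \<in> {0<..<1 / (2 * c)}) (at_right 0)"
    using c by (intro eventually_at_right_real) simp
  then show ?thesis
  proof (eventually_elim, intro allI impI)
    fix \<tau> x V assume \<tau>: "\<tau> \<in> {0<..<1 / (2 * c)}" and x: "norm x \<le> R" "f x \<le> C"
      and le: "1 / (2 * \<tau>) * (norm (V - x))\<^sup>2 + f V \<le> f x"
    show "norm (V - x) \<le> \<rho>"
    proof (rule ccontr)
      assume far: "\<not> norm (V - x) \<le> \<rho>"
      have "1 / (2 * \<tau>) > c" using \<tau> c by (simp add: field_simps)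
      then have c1: "1 / (2 * \<tau>) - 2 * A > (D + 1) / \<rho>\<^sup>2" by (simp add: c_def)
      have c0: "(D + 1) / \<rho>\<^sup>2 \<ge> 0" by (simp add: D_def)
      have "D + 1 = (D + 1) / \<rho>\<^sup>2 * \<rho>\<^sup>2" using \<open>\<rho> > 0\<close> by simp
      also have "\<dots> \<le> (1 / (2 * \<tau>) - 2 * A) * (norm (V - x))\<^sup>2"
        using c0 c1 far \<open>\<rho> > 0\<close> by (intro mult_mono power_mono) auto
      also have "\<dots> \<le> f x + 2 * A * (norm x)\<^sup>2 + B" by (rule sublevel_bound[OF low A le])
      also have "\<dots> \<le> C + 2 * A * R\<^sup>2 + B"
        using x A by (intro add_mono mult_left_mono power_mono) auto
      finally show False by (simp add: D_def)
    qed
  qed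
qed

lemma minimizer_exists:
  fixes f :: "'a::euclidean_space \<Rightarrow> real"
  assumes low: "\<And>x. f x \<ge> - A * (norm x)\<^sup>2 - B" and A: "A \<ge> 0"
    and cont: "continuous_on UNIV f" and \<tau>: "1 / (2 * \<tau>) > 2 * A"
  shows "\<exists>V. \<forall>V'. 1 / (2 * \<tau>) * (norm (V - x))\<^sup>2 + f V \<le> 1 / (2 * \<tau>) * (norm (V' - x))\<^sup>2 + f V'"
proof -
  define F where "F V = 1 / (2 * \<tau>) * (norm (V - x))\<^sup>2 + f V" for V
  define c where "c = 1 / (2 * \<tau>) - 2 * A"
  define D where "D = \<bar>f x + 2 * A * (norm x)\<^sup>2 + B\<bar>"
  define r where "r = 1 + D / c"
  have c: "c > 0" using \<tau> by (simp add: c_def)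
  have r: "r \<ge> 1" using c by (simp add: r_def D_def)
  have out: "F x < F V" if "V \<notin> cball x r" for V
  proof (rule ccontr)
    assume "\<not> F x < F V"
    then have "c * (norm (V - x))\<^sup>2 \<le> f x + 2 * A * (norm x)\<^sup>2 + B"
      unfolding c_def by (intro sublevel_bound[OF low A]) (simp add: F_def)
    moreover have "r\<^sup>2 \<le> (norm (V - x))\<^sup>2"
      using that r by (intro power_mono) (auto simp: dist_norm norm_minus_commute)
    then have "c * r\<^sup>2 \<le> c * (norm (V - x))\<^sup>2" using c by simp
    moreover have "c * r \<le> c * r\<^sup>2" using c r by (simp add: power2_eq_square)
    moreover have "c * r = c + D" using c by (simp add: r_def field_simps)
    ultimately show False using c unfolding D_def by linarith
  qed
  have "continuous_on (cball x r) F" unfolding F_def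
    by (intro continuous_intros continuous_on_subset[OF cont]) auto
  then obtain V where V: "V \<in> cball x r" "\<And>V'. V' \<in> cball x r \<Longrightarrow> F V \<le> F V'"
    using continuous_attains_inf[of "cball x r" F] r by fastforce
  have "F V \<le> F V'" for V'
    using V(2)[of V'] V(2)[of x] out[of V'] r by (cases "V' \<in> cball x r") auto
  then show ?thesis by (auto simp: F_def)
qed

lemma MS_nonempty:
  fixes f :: "'a::euclidean_space \<Rightarrow> real"
  assumes "\<And>x. \<exists>V. \<forall>V'. 1 / (2 * \<tau>) * (norm (V - x))\<^sup>2 + f V \<le> 1 / (2 * \<tau>) * (norm (V' - x))\<^sup>2 + f V'"
  shows "MS \<tau> f x\<^sub>0 \<noteq> {}"
proof -
  from assms obtain m where m: "\<And>x V'. 1 / (2 * \<tau>) * (norm (m x - x))\<^sup>2 + f (m x)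
      \<le> 1 / (2 * \<tau>) * (norm (V' - x))\<^sup>2 + f V'" by metis
  define U where "U n = (m ^^ n) x\<^sub>0" for n
  have "U n = m (U (n - 1))" if "n \<ge> 1" for n
    using that by (cases n) (auto simp: U_def)
  then have "U \<in> MS \<tau> f x\<^sub>0" using m by (auto simp: MS_def U_def[of 0])
  then show ?thesis by blast
qed

lemma discrete_solutions_nonempty:
  fixes f :: "'a::euclidean_space \<Rightarrow> real"
  assumes "MS \<tau> f x\<^sub>0 \<noteq> {}" "\<tau> > 0"
  shows "discrete_solutions \<tau> f x\<^sub>0 \<noteq> {}"
proof -
  obtain U where U: "U \<in> MS \<tau> f x\<^sub>0" using assms by blast
  define w where "w = restrict (\<lambda>t. U (nat \<lceil>t / \<tau>\<rceil>)) {0..}"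
  have "w t = U n" if "n \<ge> 1" "t \<in> {(real n - 1) * \<tau> <.. real n * \<tau>}" for n t
  proof -
    have "real n - 1 < t / \<tau>" "t / \<tau> \<le> real n" using that assms by (auto simp: field_simps)
    then have "\<lceil>t / \<tau>\<rceil> = int n" by (auto simp: ceiling_eq_iff)
    moreover have "0 \<le> (real n - 1) * \<tau>" using that(1) assms by simp
    then have "t \<ge> 0" using that(2) by auto
    ultimately show ?thesis by (simp add: w_def)
  qed
  moreover have "w 0 = x\<^sub>0" using U by (simp add: w_def MS_def)
  ultimately have "w \<in> discrete_solutions \<tau> f x\<^sub>0"
    using U unfolding discrete_solutions_def by (auto simp: w_def)
  then show ?thesis by blast
qed

section \<open>Discrete solutions follow the path\<close>

text \<open>A path that almost follows \<open>-g\<close>, and whose energy \<open>b\<close> differs from \<open>\<phi>\<close> on the path by a function with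
  Lipschitz constant \<open>L / 4\<close> in space. The factor \<open>1 / 4\<close> leaves room for cones of slope \<open>L\<close>, and \<open>1 / 64\<close>
  makes the error in the flow equation negligible compared with \<open>L\<close>.\<close>

locale driven_path = polygonal_path t K w b v
  for t :: "nat \<Rightarrow> real" and K and w :: "real \<Rightarrow> 'a::euclidean_space" and b v +
  fixes \<phi> :: "'a \<Rightarrow> real" and g :: "'a \<Rightarrow> 'a" and L A B :: real
  assumes grad: "\<And>x. GDERIV \<phi> x :> g x"
    and g_continuous: "continuous_on UNIV g"
    and L: "L > 0" and A: "A \<ge> 0"
    and lower: "\<And>x. \<phi> x \<ge> - A * (norm x)\<^sup>2 - B"
    and residual: "\<And>k r. k < K \<Longrightarrow> t k \<le> r \<Longrightarrow> r \<le> t (Suc k) \<Longrightarrow> norm (v k + g (w r)) \<le> L / 64"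
    and perturbation_Lipschitz: "\<And>r s. 0 \<le> r \<Longrightarrow> r \<le> t K \<Longrightarrow> 0 \<le> s \<Longrightarrow> s \<le> t K \<Longrightarrow>
      \<bar>(b r - \<phi> (w r)) - (b s - \<phi> (w s))\<bar> \<le> L / 4 * norm (w r - w s)"
begin

definition a :: "real \<Rightarrow> real" where "a r = b r - \<phi> (w r)"

text \<open>The McShane extension of the difference \<open>a\<close> from the path to the whole space.\<close>

definition \<psi> :: "'a \<Rightarrow> real" where "\<psi> V = (INF r \<in> {0..t K}. a r + L * norm (V - w r))"

definition f :: "'a \<Rightarrow> real" where "f V = \<phi> V + \<psi> V"

lemma a_diff:
  assumes "0 \<le> r" "r \<le> t K" "0 \<le> s" "s \<le> t K"
  shows "\<bar>a r - a s\<bar> \<le> L / 4 * norm (w r - w s)"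
  using perturbation_Lipschitz assms by (simp add: a_def)

lemma \<phi>_continuous: "continuous_on S \<phi>"
  by (meson GDERIV_DERIV_compose continuous_at_imp_continuous_on gderiv_def grad has_derivative_continuous)

lemma a_continuous: "continuous_on {0..t K} a"
  unfolding a_def
  by (intro continuous_on_diff b_continuous continuous_on_compose2[OF \<phi>_continuous[of UNIV] w_continuous]) auto

lemma \<psi>_attained:
  obtains r where "0 \<le> r" "r \<le> t K" "\<psi> V = a r + L * norm (V - w r)"
    "\<And>s. 0 \<le> s \<Longrightarrow> s \<le> t K \<Longrightarrow> \<psi> V \<le> a s + L * norm (V - w s)"
proof -
  define h where "h r = a r + L * norm (V - w r)" for r
  have "continuous_on {0..t K} h" unfolding h_def
    by (intro continuous_intros a_continuous w_continuous)
  then obtain r where r: "r \<in> {0..t K}" "\<And>s. s \<in> {0..t K} \<Longrightarrow> h r \<le> h s"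
    using continuous_attains_inf[of "{0..t K}" h] t_K_nonneg by force
  have "\<psi> V = h r" unfolding \<psi>_def h_def[symmetric]
    by (rule cInf_eq_minimum) (use r in auto)
  then show thesis using r that[of r] by (simp add: h_def)
qed

lemma \<psi>_le: "0 \<le> r \<Longrightarrow> r \<le> t K \<Longrightarrow> \<psi> V \<le> a r + L * norm (V - w r)"
  using \<psi>_attained[of V] by metis

lemma \<psi>_on_path:
  assumes "0 \<le> r" "r \<le> t K"
  shows "\<psi> (w r) = a r"
proof -
  obtain s where s: "0 \<le> s" "s \<le> t K" "\<psi> (w r) = a s + L * norm (w r - w s)"
    using \<psi>_attained by metis
  have "L / 4 * norm (w r - w s) \<le> L * norm (w r - w s)" using L by (intro mult_right_mono) auto
  then have "a r \<le> a s + L * norm (w r - w s)" using a_diff[of r s] assms s by linarith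
  then show ?thesis using \<psi>_le[OF assms, of "w r"] s by simp
qed

lemma f_on_path: "0 \<le> r \<Longrightarrow> r \<le> t K \<Longrightarrow> f (w r) = b r"
  by (simp add: f_def \<psi>_on_path a_def)

lemma \<psi>_Lipschitz: "\<psi> x - \<psi> y \<le> L * norm (x - y)"
proof -
  obtain s where s: "0 \<le> s" "s \<le> t K" "\<psi> y = a s + L * norm (y - w s)"
    using \<psi>_attained by metis
  have "L * norm (x - w s) \<le> L * (norm (x - y) + norm (y - w s))"
    using L norm_triangle_ineq[of "x - y" "y - w s"] by (intro mult_left_mono) auto
  then show ?thesis using \<psi>_le[OF s(1,2), of x] s(3) by (simp add: algebra_simps)
qed

lemma f_continuous: "continuous_on UNIV f"
proof -
  have "L-lipschitz_on UNIV \<psi>"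
  proof (rule lipschitz_onI)
    show "dist (\<psi> x) (\<psi> y) \<le> L * dist x y" for x y
      using \<psi>_Lipschitz[of x y] \<psi>_Lipschitz[of y x]
      by (auto simp: dist_real_def dist_norm norm_minus_commute abs_le_iff)
  qed (use L in simp)
  then have "continuous_on UNIV \<psi>" by (rule lipschitz_on_continuous_on)
  then show ?thesis unfolding f_def by (intro continuous_on_add \<phi>_continuous)
qed

lemma f_lower: "f x \<ge> - (A + L) * (norm x)\<^sup>2 - (B + L - \<psi> 0)"
proof -
  have "norm x \<le> 1 + (norm x)\<^sup>2"
    using zero_le_power2[of "norm x - 1 / 2"] by (simp add: power2_diff power_divide)
  then have "L * norm x \<le> L * (1 + (norm x)\<^sup>2)" using L by simp
  then show ?thesis using lower[of x] \<psi>_Lipschitz[of 0 x] by (simp add: f_def algebra_simps)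
qed

text \<open>The last conclusion is the exact advance by \<open>\<tau>\<close> of steps that stay on one edge: there the functional
  is a quadratic polynomial in the time parameter, with minimum at \<open>s + \<tau>\<close>. The assumption on the endpoint
  says that the path is not yet exhausted, or ends at an almost critical point, where resting is almost a
  step of the flow.\<close>

lemma step_from_path:
  assumes "\<delta> > 0"
  shows "eventually (\<lambda>\<tau>. \<forall>s V. 0 \<le> s \<longrightarrow> s \<le> t K \<longrightarrow>
      (s + \<tau> \<le> t K \<or> norm (g (w (t K))) \<le> L / 64) \<longrightarrow>
      (\<forall>V'. 1 / (2 * \<tau>) * (norm (V - w s))\<^sup>2 + f V \<le> 1 / (2 * \<tau>) * (norm (V' - w s))\<^sup>2 + f V') \<longrightarrow>
      (\<exists>s'. s \<le> s' \<and> s' \<le> t K \<and> s' \<le> s + \<delta> \<and> V = w s' \<and>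
        (\<forall>k<K. t k \<le> s \<longrightarrow> s' < t (Suc k) \<longrightarrow> s' = s + \<tau>))) (at_right 0)"
proof -
  obtain C where C: "C > 0"
    "\<And>r s. 0 \<le> r \<Longrightarrow> r \<le> t K \<Longrightarrow> 0 \<le> s \<Longrightarrow> s \<le> t K \<Longrightarrow> norm (w s - w r) \<le> C * \<bar>s - r\<bar>"
    using w_Lipschitz by metis
  have "bounded (w ` {0..t K})"
    by (intro compact_imp_bounded compact_continuous_image w_continuous) simp
  then obtain R where R: "\<And>r. 0 \<le> r \<Longrightarrow> r \<le> t K \<Longrightarrow> norm (w r) \<le> R"
    unfolding bounded_iff by force
  have "uniformly_continuous_on (cball 0 (R + 1)) g"
    by (intro compact_uniformly_continuous continuous_on_subset[OF g_continuous]) auto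
  then obtain \<rho>\<^sub>1 where \<rho>\<^sub>1: "\<rho>\<^sub>1 > 0" "\<And>x y. x \<in> cball 0 (R + 1) \<Longrightarrow> y \<in> cball 0 (R + 1) \<Longrightarrow>
      dist y x < \<rho>\<^sub>1 \<Longrightarrow> dist (g y) (g x) < L / 64"
    using L by (elim uniformly_continuous_onE[of _ _ "L / 64"]) auto
  define \<rho> where "\<rho> = min (\<rho>\<^sub>1 / 2) 1"
  have \<rho>: "\<rho> > 0" "\<rho> \<le> 1" using \<rho>\<^sub>1(1) by (auto simp: \<rho>_def)
  have g_close: "norm (g y - g x) \<le> L / 64"
    if "norm x \<le> R" "norm (y - x) \<le> \<rho>" for x y
  proof -
    have "norm y \<le> R + 1" using that \<rho>(2) norm_triangle_ineq[of "y - x" x] by simp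
    moreover have "dist y x < \<rho>\<^sub>1" using that(2) \<rho>\<^sub>1(1) by (auto simp: \<rho>_def dist_norm)
    ultimately show ?thesis using \<rho>\<^sub>1(2)[of x y] that(1) by (simp add: dist_norm)
  qed
  obtain \<rho>\<^sub>2 where \<rho>\<^sub>2: "\<rho>\<^sub>2 > 0"
    "\<And>r s. 0 \<le> r \<Longrightarrow> r \<le> t K \<Longrightarrow> 0 \<le> s \<Longrightarrow> s \<le> t K \<Longrightarrow> norm (w s - w r) < \<rho>\<^sub>2 \<Longrightarrow> \<bar>s - r\<bar> < \<delta>"
    using w_inverse_modulus[OF assms] by metis
  have loc: "eventually (\<lambda>\<tau>. \<forall>x V. norm x \<le> R \<longrightarrow> f x \<le> b 0 \<longrightarrow>
    1 / (2 * \<tau>) * (norm (V - x))\<^sup>2 + f V \<le> f x \<longrightarrow> norm (V - x) \<le> \<rho> / 4) (at_right 0)"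
    using f_lower by (rule sublevel_localized) (use A L \<rho> in auto)
  have "0 < \<rho> / (4 * C)" "0 < \<rho>\<^sub>2 / (C + L)" using \<rho> C(1) \<rho>\<^sub>2(1) L by auto
  then have "eventually (\<lambda>\<tau>. \<tau> \<in> {0<..<\<rho> / (4 * C)}) (at_right 0)"
    "eventually (\<lambda>\<tau>. \<tau> \<in> {0<..<\<rho>\<^sub>2 / (C + L)}) (at_right 0)"
    by (simp_all only: eventually_at_right_real)
  with loc show ?thesis
  proof (eventually_elim, intro allI impI)
    fix \<tau> s V
    assume loc: "\<forall>x V. norm x \<le> R \<longrightarrow> f x \<le> b 0 \<longrightarrow>
        1 / (2 * \<tau>) * (norm (V - x))\<^sup>2 + f V \<le> f x \<longrightarrow> norm (V - x) \<le> \<rho> / 4"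
      and "\<tau> \<in> {0<..<\<rho> / (4 * C)}" "\<tau> \<in> {0<..<\<rho>\<^sub>2 / (C + L)}"
      and s: "0 \<le> s" "s \<le> t K"
      and end_or: "s + \<tau> \<le> t K \<or> norm (g (w (t K))) \<le> L / 64"
      and min: "\<forall>V'. 1 / (2 * \<tau>) * (norm (V - w s))\<^sup>2 + f V \<le> 1 / (2 * \<tau>) * (norm (V' - w s))\<^sup>2 + f V'"
    then have \<tau>: "\<tau> > 0" "C * \<tau> \<le> \<rho> / 4" "(C + L) * \<tau> < \<rho>\<^sub>2"
      using C(1) L by (auto simp: field_simps)
    \<comment> \<open>The competitor: the path itself after time \<open>\<tau>\<close>, or its endpoint.\<close>
    define s1 where "s1 = min (s + \<tau>) (t K)"
    define G where "G = g (w s1)"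
    have s1: "0 \<le> s1" "s1 \<le> t K" "s \<le> s1" "s1 \<le> s + \<tau>" using s \<tau> by (auto simp: s1_def)
    have near: "norm (w s1 - w q) \<le> C * \<tau>" if "s \<le> q" "q \<le> s1" for q
    proof -
      have "norm (w s1 - w q) \<le> C * \<bar>s1 - q\<bar>" using C(2)[of q s1] that s s1 by simp
      also have "\<dots> \<le> C * \<tau>" using that s1 C(1) by (intro mult_left_mono) auto
      finally show ?thesis .
    qed
    have "norm (w s1 - w s + (s1 - s) *\<^sub>R G) \<le> L / 32 * (s1 - s)"
    proof (rule slope_bound)
      fix k q assume q: "k < K" "t k \<le> q" "q \<le> t (Suc k)" "s \<le> q" "q \<le> s1"
      have "norm (g (w q) - G) \<le> L / 64" unfolding G_def
        using near[of q] q \<tau>(2) R[of s1] s1 \<rho> by (intro g_close) (auto simp: norm_minus_commute)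
      with residual[of k q] q norm_triangle_ineq4[of "v k + g (w q)" "g (w q) - G"]
      show "norm (v k + G) \<le> L / 32" by simp
    qed (use s s1 in auto)
    moreover have "norm ((s + \<tau> - s1) *\<^sub>R G) \<le> L / 32 * (s + \<tau> - s1)"
    proof (cases "s + \<tau> \<le> t K")
      case False
      then have "norm G \<le> L / 32" using end_or L by (simp add: G_def s1_def)
      from mult_left_mono[OF this, of "s + \<tau> - s1"] show ?thesis
        using s1 by (simp add: mult.commute)
    qed (simp add: s1_def)
    ultimately have res: "norm (w s1 - w s + \<tau> *\<^sub>R G) \<le> L / 32 * \<tau>"
      using norm_triangle_ineq[of "w s1 - w s + (s1 - s) *\<^sub>R G" "(s + \<tau> - s1) *\<^sub>R G"]
      by (simp add: algebra_simps)
    have "b s \<le> b 0" using b_decreasing[of 0 s] s by (cases "s = 0") auto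
    then have "norm (V - w s) \<le> \<rho> / 4"
      using loc min[rule_format, of "w s"] R[OF s] f_on_path[OF s] by auto
    then have V: "norm (V - w s1) \<le> \<rho> / 2"
      using near[of s] s1 \<tau>(2) norm_triangle_ineq4[of "V - w s" "w s1 - w s"] by simp
    have \<phi>: "\<bar>\<phi> p - \<phi> q - inner G (p - q)\<bar> \<le> L / 64 * norm (p - q)"
      if "norm (p - w s1) \<le> \<rho>" "norm (q - w s1) \<le> \<rho>" for p q
    proof (rule gradient_bound[OF grad, of "cball (w s1) \<rho>"])
      show "norm (g z - G) \<le> L / 64" if "z \<in> cball (w s1) \<rho>" for z
        unfolding G_def using that R[of s1] s1
        by (intro g_close) (auto simp: dist_norm norm_minus_commute)
    qed (use that in \<open>auto simp: dist_norm norm_minus_commute\<close>)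
    obtain r where r: "0 \<le> r" "r \<le> t K" "\<psi> V = a r + L * norm (V - w r)"
      using \<psi>_attained by metis
    have min1: "1 / (2 * \<tau>) * (norm (V - w s))\<^sup>2 + \<phi> V + (a r + L * norm (V - w r))
        \<le> 1 / (2 * \<tau>) * (norm (w q - w s))\<^sup>2 + \<phi> (w q) + a q" if "0 \<le> q" "q \<le> t K" for q
      using min[rule_format, of "w q"] r(3) \<psi>_on_path[OF that] by (simp add: f_def)
    have land: "V = w r" "norm (V - w s1) \<le> L * \<tau>"
      using step_lands_on_path[OF L \<tau>(1) \<phi> res V _ min1[OF s1(1,2)] min1[OF r(1,2)]]
        a_diff[OF s1(1,2) r(1,2)] by (auto simp: norm_minus_commute)
    have "norm (w r - w s) \<le> (C + L) * \<tau>"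
      using norm_triangle_ineq[of "w r - w s1" "w s1 - w s"] land near[of s] s1
      by (simp add: algebra_simps)
    then have "\<bar>r - s\<bar> < \<delta>" using \<rho>\<^sub>2(2)[OF s r(1,2)] \<tau>(3) by simp
    moreover have path: "1 / (2 * \<tau>) * (norm (w r - w s))\<^sup>2 + b r \<le> 1 / (2 * \<tau>) * (norm (w q - w s))\<^sup>2 + b q"
      if "0 \<le> q" "q \<le> t K" for q
      using min1[OF that] land(1) by (simp add: a_def)
    \<comment> \<open>A step backwards would increase the energy \<open>b\<close>.\<close>
    have "s \<le> r"
    proof (rule ccontr)
      assume "\<not> s \<le> r"
      then have "b s < b r" using b_decreasing[of r s] r s by simp
      moreover have "0 \<le> 1 / (2 * \<tau>) * (norm (w r - w s))\<^sup>2" using \<tau> by simp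
      ultimately show False using path[OF s] by simp
    qed
    moreover have "r = s + \<tau>" if k: "k < K" "t k \<le> s" "r < t (Suc k)" for k
    proof -
      define q where "q = min (s + \<tau>) (t (Suc k))"
      define c where "c = (norm (v k))\<^sup>2"
      have c: "c > 0" using v_nonzero[OF k(1)] by (simp add: c_def)
      have q: "s \<le> q" "q \<le> t (Suc k)" using \<open>s \<le> r\<close> k \<tau> by (auto simp: q_def)
      have qK: "q \<le> t K" using q t_mono[of "Suc k" K] k by simp
      have edge: "1 / (2 * \<tau>) * (norm (w p - w s))\<^sup>2 + b p - b s = c / (2 * \<tau>) * ((p - s - \<tau>)\<^sup>2 - \<tau>\<^sup>2)"
        if "s \<le> p" "p \<le> t (Suc k)" for p
      proof -
        have "(norm (w p - w s))\<^sup>2 = (p - s)\<^sup>2 * c" "b p - b s = - (p - s) * c"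
          using w_diff[of k s p] b_diff[of k s p] that k by (simp_all add: c_def power_mult_distrib)
        moreover have "1 / (2 * \<tau>) * ((p - s)\<^sup>2 * c) + (- (p - s) * c)
            = c / (2 * \<tau>) * ((p - s - \<tau>)\<^sup>2 - \<tau>\<^sup>2)"
          using \<tau> by (simp add: power2_eq_square field_simps)
        ultimately show ?thesis by simp
      qed
      have "c / (2 * \<tau>) * ((r - s - \<tau>)\<^sup>2 - \<tau>\<^sup>2) \<le> c / (2 * \<tau>) * ((q - s - \<tau>)\<^sup>2 - \<tau>\<^sup>2)"
        using path[of q] edge[of r] edge[of q] q qK \<open>s \<le> r\<close> k s by simp
      moreover have "c / (2 * \<tau>) > 0" using c \<tau> by simp
      ultimately have sq: "(r - s - \<tau>)\<^sup>2 \<le> (q - s - \<tau>)\<^sup>2"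
        by (simp only: mult_le_cancel_left_pos)
      show ?thesis
      proof (cases "s + \<tau> \<le> t (Suc k)")
        case True then show ?thesis using sq by (simp add: q_def)
      next
        case False
        then have "q - s - \<tau> \<le> 0" "r - s - \<tau> < q - s - \<tau>" using k by (auto simp: q_def)
        then have "(q - s - \<tau>)\<^sup>2 < (r - s - \<tau>)\<^sup>2"
          using power_strict_mono[of "- (q - s - \<tau>)" "- (r - s - \<tau>)" 2] by (simp add: power2_commute)
        then show ?thesis using sq by simp
      qed
    qed
    ultimately show "\<exists>s'. s \<le> s' \<and> s' \<le> t K \<and> s' \<le> s + \<delta> \<and> V = w s' \<and>
        (\<forall>k<K. t k \<le> s \<longrightarrow> s' < t (Suc k) \<longrightarrow> s' = s + \<tau>)"
      using r land by (intro exI[of _ r]) auto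
  qed
qed

text \<open>Each step over a vertex costs an error of at most \<open>\<delta>\<close> in the time parameter; the number of vertices
  passed so far is the bookkeeping of these errors.\<close>

definition crossed :: "real \<Rightarrow> nat" where
  "crossed s = card {k \<in> {1..K}. t k \<le> s}"

lemma crossed_le: "crossed s \<le> K"
proof -
  have "card {k \<in> {1..K}. t k \<le> s} \<le> card {1..K}" by (intro card_mono) auto
  then show ?thesis by (simp add: crossed_def)
qed

lemma crossed_mono: "s \<le> s' \<Longrightarrow> crossed s \<le> crossed s'"
  unfolding crossed_def by (intro card_mono) auto

lemma crossed_less:
  assumes "k < K" "s < t (Suc k)" "t (Suc k) \<le> s'"
  shows "crossed s < crossed s'"
  unfolding crossed_def
proof (rule psubset_card_mono)
  have "Suc k \<in> {k \<in> {1..K}. t k \<le> s'} - {k \<in> {1..K}. t k \<le> s}" using assms by auto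
  moreover have "{k \<in> {1..K}. t k \<le> s} \<subseteq> {k \<in> {1..K}. t k \<le> s'}" using assms by auto
  ultimately show "{k \<in> {1..K}. t k \<le> s} \<subset> {k \<in> {1..K}. t k \<le> s'}" by blast
qed simp

text \<open>The time parameter of the \<open>n\<close>-th iterate differs from \<open>n \<tau>\<close> only by the errors made at the vertices.\<close>

lemma iterates_follow_path:
  assumes \<tau>: "0 < \<tau>" "\<tau> \<le> \<delta>"
    and step: "\<forall>s V. 0 \<le> s \<longrightarrow> s \<le> t K \<longrightarrow>
      (s + \<tau> \<le> t K \<or> norm (g (w (t K))) \<le> L / 64) \<longrightarrow>
      (\<forall>V'. 1 / (2 * \<tau>) * (norm (V - w s))\<^sup>2 + f V \<le> 1 / (2 * \<tau>) * (norm (V' - w s))\<^sup>2 + f V') \<longrightarrow>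
      (\<exists>s'. s \<le> s' \<and> s' \<le> t K \<and> s' \<le> s + \<delta> \<and> V = w s' \<and>
        (\<forall>k<K. t k \<le> s \<longrightarrow> s' < t (Suc k) \<longrightarrow> s' = s + \<tau>))"
    and end_or: "T + real K * \<delta> \<le> t K \<or> norm (g (w (t K))) \<le> L / 64"
    and U: "U \<in> MS \<tau> f (w 0)"
    and n: "real n * \<tau> \<le> T"
  shows "\<exists>s. 0 \<le> s \<and> s \<le> t K \<and> U n = w s \<and> \<bar>s - min (real n * \<tau>) (t K)\<bar> \<le> real (crossed s) * \<delta>"
  using n
proof (induction n)
  case 0
  then show ?case using U t_K_nonneg \<tau> by (intro exI[of _ 0]) (auto simp: MS_def)
next
  case (Suc n)
  define m m' where "m = min (real n * \<tau>) (t K)" and "m' = min (real (Suc n) * \<tau>) (t K)"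
  have n: "real n * \<tau> + \<tau> \<le> T" using Suc.prems by (simp add: algebra_simps)
  then obtain s where s: "0 \<le> s" "s \<le> t K" "U n = w s" and err: "\<bar>s - m\<bar> \<le> real (crossed s) * \<delta>"
    using Suc.IH \<tau> unfolding m_def by auto
  have m': "m' = min (m + \<tau>) (t K)" using \<tau> by (auto simp: m_def m'_def algebra_simps min_def)
  have "real (crossed s) * \<delta> \<le> real K * \<delta>" using crossed_le \<tau> by (intro mult_right_mono) auto
  then have "s \<le> real n * \<tau> + real K * \<delta>" using err by (simp add: m_def min_def split: if_splits)
  then have "s + \<tau> \<le> t K \<or> norm (g (w (t K))) \<le> L / 64" using end_or n by auto
  moreover have "\<forall>V'. 1 / (2 * \<tau>) * (norm (U (Suc n) - w s))\<^sup>2 + f (U (Suc n))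
      \<le> 1 / (2 * \<tau>) * (norm (V' - w s))\<^sup>2 + f V'"
    using U s(3) unfolding MS_def by (auto dest!: spec[of _ "Suc n"])
  ultimately obtain s' where s': "s \<le> s'" "s' \<le> t K" "s' \<le> s + \<delta>" "U (Suc n) = w s'"
    and on_edge: "\<And>k. k < K \<Longrightarrow> t k \<le> s \<Longrightarrow> s' < t (Suc k) \<Longrightarrow> s' = s + \<tau>"
    using step s by metis
  have mono: "real (crossed s) * \<delta> \<le> real (crossed s') * \<delta>"
    using crossed_mono[OF s'(1)] \<tau> by (intro mult_right_mono) auto
  have "\<bar>s' - m'\<bar> \<le> real (crossed s') * \<delta>"
  proof (cases "s = t K")
    case True
    then have "\<bar>s' - m'\<bar> \<le> \<bar>s - m\<bar>" using s' \<tau> unfolding m' by (auto simp: m_def)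
    then show ?thesis using err mono by simp
  next
    case False
    then obtain k where k: "k < K" "t k \<le> s" "s < t (Suc k)" using edge_exists[of s] s by auto
    show ?thesis
    proof (cases "s' < t (Suc k)")
      case True
      then have "s' = s + \<tau>" using on_edge k by blast
      then have "\<bar>s' - m'\<bar> \<le> \<bar>s - m\<bar>" using s'(2) unfolding m' by (auto simp: min_def)
      then show ?thesis using err mono by simp
    next
      case False
      then have "crossed s + 1 \<le> crossed s'" using crossed_less[of k s s'] k by simp
      then have "real (crossed s + 1) * \<delta> \<le> real (crossed s') * \<delta>"
        using \<tau> by (intro mult_right_mono) (auto simp del: of_nat_add)
      moreover have "\<bar>(s' - s) - (m' - m)\<bar> \<le> \<delta>" using s' \<tau> unfolding m' by (auto simp: m_def)
      ultimately show ?thesis using err by (simp add: algebra_simps)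
    qed
  qed
  then show ?case using s s' unfolding m'_def by (intro exI[of _ s']) auto
qed

theorem discrete_solutions_follow_path:
  assumes e: "e > 0" and end_or: "T + 1 \<le> t K \<or> norm (g (w (t K))) \<le> L / 64"
  shows "eventually (\<lambda>\<tau>. \<forall>U \<in> MS \<tau> f (w 0). \<forall>n. real n * \<tau> \<le> T \<longrightarrow>
    norm (U n - w (min (real n * \<tau>) (t K))) \<le> e) (at_right 0)"
proof -
  obtain C where C: "C > 0"
    "\<And>r s. 0 \<le> r \<Longrightarrow> r \<le> t K \<Longrightarrow> 0 \<le> s \<Longrightarrow> s \<le> t K \<Longrightarrow> norm (w s - w r) \<le> C * \<bar>s - r\<bar>"
    using w_Lipschitz by metis
  define \<delta> where "\<delta> = min 1 (e / C) / (real K + 1)"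
  have \<delta>: "\<delta> > 0" using e C by (simp add: \<delta>_def)
  have "real K * \<delta> \<le> (real K + 1) * \<delta>" using \<delta> by (intro mult_right_mono) auto
  also have "\<dots> = min 1 (e / C)" by (simp add: \<delta>_def)
  finally have K\<delta>: "real K * \<delta> \<le> 1" "C * (real K * \<delta>) \<le> e" using C(1) by (auto simp: field_simps)
  have "eventually (\<lambda>\<tau>. \<tau> \<in> {0<..<\<delta>}) (at_right 0)" using \<delta> by (rule eventually_at_right_real)
  with step_from_path[OF \<delta>] show ?thesis
  proof (eventually_elim, intro ballI allI impI, goal_cases)
    case (1 \<tau> U n)
    then have "T + real K * \<delta> \<le> t K \<or> norm (g (w (t K))) \<le> L / 64" using end_or K\<delta> by auto
    then obtain s where s: "0 \<le> s" "s \<le> t K" "U n = w s"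
        "\<bar>s - min (real n * \<tau>) (t K)\<bar> \<le> real (crossed s) * \<delta>"
      using iterates_follow_path[of \<tau> \<delta> T U n] 1 by auto
    have "real (crossed s) * \<delta> \<le> real K * \<delta>" using crossed_le \<delta> by (intro mult_right_mono) auto
    then have "C * \<bar>s - min (real n * \<tau>) (t K)\<bar> \<le> C * (real K * \<delta>)"
      using s C(1) by (intro mult_left_mono) auto
    then show ?case using C(2)[of "min (real n * \<tau>) (t K)" s] s K\<delta>(2) 1 t_K_nonneg by auto
  qed
qed

theorem discrete_solutions_exist:
  "eventually (\<lambda>\<tau>. discrete_solutions \<tau> f x \<noteq> {}) (at_right 0)"
proof -
  have "eventually (\<lambda>\<tau>. \<tau> \<in> {0<..<1 / (4 * (A + L))}) (at_right 0)"
    using A L by (intro eventually_at_right_real) simp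
  then show ?thesis
  proof eventually_elim
    case (elim \<tau>)
    then have "1 / (2 * \<tau>) > 2 * (A + L)" using A L by (simp add: field_simps)
    then show ?case
      using elim A L
      by (intro discrete_solutions_nonempty MS_nonempty minimizer_exists[OF f_lower _ f_continuous]) auto
  qed
qed

end

section \<open>Last-exit chains\<close>

text \<open>The next point is the last one at distance at most \<open>h\<close> from the current one, so all later points
  of the curve keep the distance \<open>h\<close>. Uniform continuity bounds the time between successive points from
  below, hence the chain is finite.\<close>

lemma last_exit_chain:
  fixes u :: "real \<Rightarrow> 'a::real_normed_vector"
  assumes cont: "continuous_on {0..T} u" and h: "h > 0" and T: "T \<ge> 0"
  obtains K t where "t 0 = 0" "\<And>k. k < K \<Longrightarrow> t k < t (Suc k)" "t K \<le> T"
    "\<And>k. k < K \<Longrightarrow> norm (u (t (Suc k)) - u (t k)) = h"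
    "\<And>i j. i < j \<Longrightarrow> j \<le> K \<Longrightarrow> norm (u (t j) - u (t i)) \<ge> h"
    "norm (u T - u (t K)) \<le> h"
proof -
  obtain \<delta> where \<delta>: "\<delta> > 0" "\<And>r s. r \<in> {0..T} \<Longrightarrow> s \<in> {0..T} \<Longrightarrow> dist s r < \<delta> \<Longrightarrow> dist (u s) (u r) < h"
    using compact_uniformly_continuous[OF cont compact_Icc] h by (rule uniformly_continuous_onE) blast
  define P where "P s K t \<longleftrightarrow> t 0 = s \<and> (\<forall>k\<le>K. s \<le> t k \<and> t k \<le> T) \<and> (\<forall>k<K. t k < t (Suc k)) \<and>
    (\<forall>k<K. norm (u (t (Suc k)) - u (t k)) = h) \<and>
    (\<forall>i j. i < j \<longrightarrow> j \<le> K \<longrightarrow> norm (u (t j) - u (t i)) \<ge> h) \<and> norm (u T - u (t K)) \<le> h"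
    for s :: real and K :: nat and t :: "nat \<Rightarrow> real"
  have "\<exists>K t. P s K t" if "0 \<le> s" "s \<le> T" "T - s \<le> real n * \<delta>" for s n
    using that
  proof (induction n arbitrary: s)
    case 0
    then have "P s 0 (\<lambda>_. s)" using h by (auto simp: P_def)
    then show ?case by blast
  next
    case (Suc n)
    show ?case
    proof (cases "norm (u T - u s) \<le> h")
      case True
      then have "P s 0 (\<lambda>_. s)" using Suc.prems by (auto simp: P_def)
      then show ?thesis by blast
    next
      case False
      define E where "E = {r \<in> {s..T}. norm (u r - u s) \<le> h}"
      have cont_s: "continuous_on {s..T} (\<lambda>r. norm (u r - u s))"
        using Suc.prems by (intro continuous_intros continuous_on_subset[OF cont]) auto
      have "closed E" unfolding E_def
        using cont_s by (intro continuous_on_closed_Collect_le continuous_on_const) auto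
      then have "compact ({s..T} \<inter> E)" by (intro compact_Int_closed compact_Icc)
      moreover have "{s..T} \<inter> E = E" by (auto simp: E_def)
      ultimately have "compact E" by simp
      moreover have "s \<in> E" using Suc.prems h by (simp add: E_def)
      ultimately obtain s' where s': "s' \<in> E" "\<And>r. r \<in> E \<Longrightarrow> r \<le> s'"
        using compact_attains_sup[of E] by blast
      have s'T: "s \<le> s'" "s' < T" using s'(1) False by (auto simp: E_def less_le)
      have out: "norm (u r - u s) > h" if "s' < r" "r \<le> T" for r
        using s'(2)[of r] that s'T by (fastforce simp: E_def)
      have "norm (u s' - u s) = h"
      proof (rule ccontr)
        assume "norm (u s' - u s) \<noteq> h"
        then have "norm (u s' - u s) < h" using s'(1) by (simp add: E_def)
        moreover have "continuous_on {s'..T} (\<lambda>r. norm (u r - u s))"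
          using s'T by (intro continuous_on_subset[OF cont_s]) auto
        ultimately obtain r where r: "s' \<le> r" "r \<le> T" "norm (u r - u s) = h"
          using IVT'[of "\<lambda>r. norm (u r - u s)" s' h T] False s'T by auto
        then show False using out[of r] \<open>norm (u s' - u s) < h\<close> by (cases "r = s'") auto
      qed
      moreover have "\<delta> \<le> s' - s"
      proof (rule ccontr)
        assume "\<not> \<delta> \<le> s' - s"
        then have "dist (u s') (u s) < h"
          using s'T Suc.prems by (intro \<delta>(2)) (auto simp: dist_real_def)
        then show False using \<open>norm (u s' - u s) = h\<close> by (simp add: dist_norm)
      qed
      then obtain K t where P: "P s' K t"
        using Suc.IH[of s'] Suc.prems s'T \<delta>(1) by (auto simp: algebra_simps)
      have sep: "norm (u (t j) - u s) \<ge> h" if "j \<le> K" for j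
        using out[of "t j"] P that \<open>norm (u s' - u s) = h\<close>
        by (cases "t j = s'") (auto simp: P_def less_le)
      have "P s (Suc K) (case_nat s t)"
        unfolding P_def
      proof (intro conjI allI impI)
        fix k assume "k < Suc K"
        then show "case_nat s t k < case_nat s t (Suc k)"
          using P \<open>\<delta> \<le> s' - s\<close> \<delta>(1) by (cases k) (auto simp: P_def)
      next
        fix k assume "k < Suc K"
        then show "norm (u (case_nat s t (Suc k)) - u (case_nat s t k)) = h"
          using P \<open>norm (u s' - u s) = h\<close> by (cases k) (auto simp: P_def)
      next
        fix i j :: nat assume "i < j" "j \<le> Suc K"
        then show "h \<le> norm (u (case_nat s t j) - u (case_nat s t i))"
          using P sep by (cases i; cases j) (auto simp: P_def)
      next
        fix k assume "k \<le> Suc K"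
        then show "s \<le> case_nat s t k" "case_nat s t k \<le> T"
          using P s'T Suc.prems by (cases k; force simp: P_def)+
      qed (use P in \<open>auto simp: P_def\<close>)
      then show ?thesis by blast
    qed
  qed
  moreover obtain n where "T / \<delta> \<le> real n" using real_arch_simple by blast
  then have "T - 0 \<le> real n * \<delta>" using \<delta>(1) by (simp add: field_simps)
  ultimately obtain K t where "P 0 K t" using T by blast
  then show thesis by (intro that[of t K]) (auto simp: P_def)
qed

lemma interpolation_exists:
  fixes t :: "nat \<Rightarrow> real" and q :: "nat \<Rightarrow> 'b::real_vector"
  assumes "\<And>k. k < K \<Longrightarrow> t k < t (Suc k)"
  shows "\<exists>w. (\<forall>k\<le>K. w (t k) = q k) \<and> (\<forall>k<K. \<forall>r. t k \<le> r \<longrightarrow> r \<le> t (Suc k) \<longrightarrow>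
    w r = q k + ((r - t k) / (t (Suc k) - t k)) *\<^sub>R (q (Suc k) - q k))"
  using assms
proof (induction K)
  case 0
  then show ?case by (intro exI[of _ "\<lambda>_. q 0"]) simp
next
  case (Suc K)
  then obtain w where w: "\<forall>k\<le>K. w (t k) = q k" "\<forall>k<K. \<forall>r. t k \<le> r \<longrightarrow> r \<le> t (Suc k) \<longrightarrow>
    w r = q k + ((r - t k) / (t (Suc k) - t k)) *\<^sub>R (q (Suc k) - q k)"
    using less_SucI by metis
  have mono: "t i \<le> t j" if "i \<le> j" "j \<le> K" for i j
    using that
  proof (induction j rule: dec_induct)
    case (step n) then show ?case using Suc.prems[of n] by simp
  qed simp
  have less: "t K < t (Suc K)" using Suc.prems by simp
  define w' where "w' r = (if r \<le> t K then w r else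
    q K + ((r - t K) / (t (Suc K) - t K)) *\<^sub>R (q (Suc K) - q K))" for r
  have "w' (t k) = q k" if "k \<le> Suc K" for k
    using that w(1) mono[of k K] less by (cases "k = Suc K") (auto simp: w'_def)
  moreover have "w' r = q k + ((r - t k) / (t (Suc k) - t k)) *\<^sub>R (q (Suc k) - q k)"
    if "k < Suc K" "t k \<le> r" "r \<le> t (Suc k)" for k r
    using that w mono[of "Suc k" K] by (cases "k = K") (auto simp: w'_def)
  ultimately show ?case by (intro exI[of _ w']) blast
qed

text \<open>Edges \<open>AB\<close> and \<open>CD\<close> of a chain whose links have length \<open>h\<close> and whose points are at least \<open>h\<close> apart: the
  squared distance of two points on them is a combination of the squared distances of the endpoints. The case
  \<open>B = C\<close> concerns consecutive edges, which meet at an angle of at least 60 degrees. The left-hand side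
  is the sum of the distances to \<open>B\<close> and to \<open>C\<close>, the endpoints that the chain visits in between.\<close>

lemma segments_apart:
  fixes A B C D :: "'a::real_inner"
  assumes h: "h \<ge> 0" and AB: "norm (A - B) = h" and CD: "norm (D - C) = h"
    and AC: "norm (A - C) \<ge> h" and AD: "norm (A - D) \<ge> h" and BD: "norm (B - D) \<ge> h"
    and BC: "B = C \<or> norm (B - C) \<ge> h"
    and \<sigma>: "0 \<le> \<sigma>" "\<sigma> \<le> 1" and \<theta>: "0 \<le> \<theta>" "\<theta> \<le> 1"
  shows "h * (\<sigma> + \<theta>) \<le> 3 * norm ((B + \<sigma> *\<^sub>R (A - B)) - (C + \<theta> *\<^sub>R (D - C)))"
proof -
  define N where "N = norm ((B + \<sigma> *\<^sub>R (A - B)) - (C + \<theta> *\<^sub>R (D - C)))"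
  define p \<alpha> \<beta> where "p = B - C" and "\<alpha> = A - B" and "\<beta> = D - C"
  have vec: "(B + \<sigma> *\<^sub>R (A - B)) - (C + \<theta> *\<^sub>R (D - C)) = p + \<sigma> *\<^sub>R \<alpha> - \<theta> *\<^sub>R \<beta>"
    "A - C = p + \<alpha>" "A - D = p + \<alpha> - \<beta>" "B - D = p - \<beta>" "A - B = \<alpha>" "D - C = \<beta>" "B - C = p"
    by (simp_all add: p_def \<alpha>_def \<beta>_def)
  have identity: "N\<^sup>2 = \<sigma> * (1 - \<theta>) * (norm (A - C))\<^sup>2 + \<sigma> * \<theta> * (norm (A - D))\<^sup>2
      + (1 - \<sigma>) * (1 - \<theta>) * (norm (B - C))\<^sup>2 + (1 - \<sigma>) * \<theta> * (norm (B - D))\<^sup>2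
      - \<sigma> * (1 - \<sigma>) * (norm (A - B))\<^sup>2 - \<theta> * (1 - \<theta>) * (norm (D - C))\<^sup>2"
    unfolding N_def vec(1) unfolding vec(2-7) power2_norm_eq_inner
    by (simp add: inner_add_left inner_add_right inner_diff_left inner_diff_right inner_commute algebra_simps)
  have sq: "(norm (A - C))\<^sup>2 \<ge> h\<^sup>2" "(norm (A - D))\<^sup>2 \<ge> h\<^sup>2" "(norm (B - D))\<^sup>2 \<ge> h\<^sup>2"
    using AC AD BD h by (auto intro: power_mono)
  have "\<sigma> * (1 - \<theta>) * (norm (A - C))\<^sup>2 \<ge> \<sigma> * (1 - \<theta>) * h\<^sup>2"
    "\<sigma> * \<theta> * (norm (A - D))\<^sup>2 \<ge> \<sigma> * \<theta> * h\<^sup>2"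
    "(1 - \<sigma>) * \<theta> * (norm (B - D))\<^sup>2 \<ge> (1 - \<sigma>) * \<theta> * h\<^sup>2"
    using \<sigma> \<theta> sq by (auto intro!: mult_left_mono)
  then have low: "N\<^sup>2 \<ge> (\<sigma> * (1 - \<theta>) + \<sigma> * \<theta> + (1 - \<sigma>) * \<theta> - \<sigma> * (1 - \<sigma>) - \<theta> * (1 - \<theta>)) * h\<^sup>2
      + (1 - \<sigma>) * (1 - \<theta>) * (norm (B - C))\<^sup>2"
    unfolding identity AB CD by (simp add: algebra_simps)
  have "(\<sigma> + \<theta>)\<^sup>2 * h\<^sup>2 \<le> 9 * N\<^sup>2"
    using BC
  proof
    assume "B = C"
    then have "(\<sigma>\<^sup>2 + \<theta>\<^sup>2 - \<sigma> * \<theta>) * h\<^sup>2 \<le> N\<^sup>2"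
      using low by (simp add: power2_eq_square algebra_simps)
    moreover have "0 \<le> 8 * \<sigma>\<^sup>2 + 8 * \<theta>\<^sup>2 - 11 * (\<sigma> * \<theta>)"
      using zero_le_power2[of "\<sigma> - \<theta>"] \<sigma> \<theta> zero_le_power2[of \<sigma>] zero_le_power2[of \<theta>] unfolding power2_diff by linarith
    then have "(\<sigma> + \<theta>)\<^sup>2 * h\<^sup>2 \<le> 9 * (\<sigma>\<^sup>2 + \<theta>\<^sup>2 - \<sigma> * \<theta>) * h\<^sup>2"
      by (intro mult_right_mono) (simp_all add: power2_sum)
    ultimately show ?thesis by linarith
  next
    assume "norm (B - C) \<ge> h"
    then have "(1 - \<sigma>) * (1 - \<theta>) * (norm (B - C))\<^sup>2 \<ge> (1 - \<sigma>) * (1 - \<theta>) * h\<^sup>2"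
      using \<sigma> \<theta> h by (intro mult_left_mono power_mono) auto
    then have "(1 - \<sigma> * (1 - \<sigma>) - \<theta> * (1 - \<theta>)) * h\<^sup>2 \<le> N\<^sup>2"
      using low by (simp add: algebra_simps)
    moreover have "(\<sigma> + \<theta>)\<^sup>2 \<le> 9 * (1 - \<sigma> * (1 - \<sigma>) - \<theta> * (1 - \<theta>))"
    proof -
      have "(\<sigma> + \<theta>)\<^sup>2 \<le> 2\<^sup>2" using \<sigma> \<theta> by (intro power_mono) auto
      then have le: "(\<sigma> + \<theta>)\<^sup>2 \<le> 4" by simp
      have "1 - \<sigma> * (1 - \<sigma>) - \<theta> * (1 - \<theta>) = (\<sigma> - 1/2)\<^sup>2 + (\<theta> - 1/2)\<^sup>2 + 1/2"
        by (simp add: power2_eq_square algebra_simps)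
      then have "1 / 2 \<le> 1 - \<sigma> * (1 - \<sigma>) - \<theta> * (1 - \<theta>)" by simp
      then have "9 * (1 / 2) \<le> 9 * (1 - \<sigma> * (1 - \<sigma>) - \<theta> * (1 - \<theta>))"
        by (rule mult_left_mono) simp
      moreover note le
      moreover have "(4::real) \<le> 9 * (1 / 2)" by simp
      ultimately show ?thesis by (meson order_trans)
    qed
    then have "(\<sigma> + \<theta>)\<^sup>2 * h\<^sup>2 \<le> 9 * (1 - \<sigma> * (1 - \<sigma>) - \<theta> * (1 - \<theta>)) * h\<^sup>2"
      by (intro mult_right_mono) auto
    ultimately show ?thesis by linarith
  qed
  then have "(h * (\<sigma> + \<theta>))\<^sup>2 \<le> (3 * N)\<^sup>2" by (simp add: power_mult_distrib mult.commute)
  then show ?thesis unfolding N_def[symmetric]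
    by (rule power2_le_imp_le) (simp add: N_def)
qed

section \<open>Energy estimates for gradient flows\<close>

locale gradient_flow =
  fixes \<phi> :: "'a::euclidean_space \<Rightarrow> real" and g :: "'a \<Rightarrow> 'a" and u :: "real \<Rightarrow> 'a"
  assumes grad: "\<And>x. GDERIV \<phi> x :> g x"
    and g_continuous: "continuous_on UNIV g"
    and flow: "\<And>t. t \<ge> 0 \<Longrightarrow> (u has_vector_derivative - g (u t)) (at t within {0..})"
begin

lemma u_continuous: "S \<subseteq> {0..} \<Longrightarrow> continuous_on S u"
  by (rule continuous_on_subset[of "{0..}"])
    (auto intro!: continuous_on_vector_derivative flow)

lemma \<phi>_continuous: "continuous_on S \<phi>"
  by (meson continuous_at_imp_continuous_on gderiv_def grad has_derivative_continuous)

text \<open>All integral estimates for the flow come from the monotonicity of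
  \<open>\<langle>u, e\<rangle> + c \<phi>(u) + \<mu> t\<close>, for suitable \<open>e\<close>, \<open>c\<close> and \<open>\<mu>\<close>.\<close>

lemma flow_decreasing:
  assumes "0 \<le> s" "s \<le> r"
    and neg: "\<And>q. s < q \<Longrightarrow> q < r \<Longrightarrow> \<mu> \<le> inner (g (u q)) e + c * (norm (g (u q)))\<^sup>2"
  shows "inner (u r - u s) e + c * (\<phi> (u r) - \<phi> (u s)) + \<mu> * (r - s) \<le> 0"
proof (cases "s = r")
  case False
  define F where "F q = inner (u q) e + c * \<phi> (u q) + \<mu> * q" for q
  have "F r \<le> F s"
  proof (rule DERIV_nonpos_imp_decreasing_open[where f = F])
    show "s \<le> r" by fact
    fix q assume q: "s < q" "q < r"
    then have "(u has_vector_derivative - g (u q)) (at q within {0<..})"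
      using assms(1) by (intro has_vector_derivative_within_subset[OF flow]) auto
    then have uq: "(u has_vector_derivative - g (u q)) (at q)"
      using q assms(1) by (simp add: at_within_open[of q "{0<..}"])
    have "(\<phi> \<circ> u has_derivative (\<lambda>h. inner h (g (u q))) \<circ> (\<lambda>x. x *\<^sub>R - g (u q))) (at q)"
      using uq grad[of "u q"] by (intro diff_chain_at) (simp_all add: gderiv_def has_vector_derivative_def)
    then have "((\<lambda>q. \<phi> (u q)) has_real_derivative inner (- g (u q)) (g (u q))) (at q)"
      unfolding has_field_derivative_def o_def
      by (rule has_derivative_eq_rhs) (simp add: fun_eq_iff mult.commute)
    moreover have "((\<lambda>q. inner (u q) e) has_real_derivative inner (- g (u q)) e) (at q)"
      using has_derivative_inner_left[OF uq[unfolded has_vector_derivative_def], of e]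
      unfolding has_field_derivative_def
      by (rule has_derivative_eq_rhs) (simp add: fun_eq_iff mult.commute)
    ultimately have "(F has_real_derivative inner (- g (u q)) e + c * inner (- g (u q)) (g (u q)) + \<mu>) (at q)"
      unfolding F_def by (auto intro!: derivative_eq_intros)
    then show "\<exists>y. (F has_real_derivative y) (at q) \<and> y \<le> 0"
      using neg[OF q] by (intro exI conjI) (auto simp: power2_norm_eq_inner)
  next
    show "continuous_on {s..r} F" unfolding F_def
      using assms(1) by (intro continuous_intros u_continuous continuous_on_compose2[OF \<phi>_continuous[of UNIV]]) auto
  qed
  then show ?thesis by (simp add: F_def inner_diff_left algebra_simps)
qed simp

text \<open>This is Cauchy-Schwarz for \<open>u r - u s = \<integral>u'\<close>, since \<open>\<phi>(u)\<close> decreases at the rate \<open>\<bar>u'\<bar>\<^sup>2\<close>. It bounds how far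
  the flow can travel between two times at which \<open>\<phi>\<close> has almost the same value.\<close>

lemma energy_dissipation:
  assumes "0 \<le> s" "s \<le> r"
  shows "(norm (u r - u s))\<^sup>2 \<le> (r - s) * (\<phi> (u s) - \<phi> (u r))"
proof (cases "s = r")
  case False
  define e d where "e = u r - u s" and "d = r - s"
  have d: "d > 0" using False assms by (simp add: d_def)
  \<comment> \<open>With these coefficients the condition of monotonicity is that \<open>d g + e\<close> has a nonnegative squared norm.\<close>
  have "inner (u r - u s) e + d / 2 * (\<phi> (u r) - \<phi> (u s)) + (- (norm e)\<^sup>2 / (2 * d)) * (r - s) \<le> 0"
  proof (rule flow_decreasing[OF assms])
    fix q
    have "0 \<le> (norm (d *\<^sub>R g (u q) + e))\<^sup>2" by simp
    also have "\<dots> = 2 * d * (inner (g (u q)) e + d / 2 * (norm (g (u q)))\<^sup>2 + (norm e)\<^sup>2 / (2 * d))"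
      using d unfolding power2_norm_eq_inner
      by (simp add: inner_add_left inner_add_right inner_commute field_simps)
    finally have "0 \<le> inner (g (u q)) e + d / 2 * (norm (g (u q)))\<^sup>2 + (norm e)\<^sup>2 / (2 * d)"
      using d by (simp add: zero_le_mult_iff)
    then show "- (norm e)\<^sup>2 / (2 * d) \<le> inner (g (u q)) e + d / 2 * (norm (g (u q)))\<^sup>2" by simp
  qed
  then have "(norm e)\<^sup>2 + d / 2 * (\<phi> (u r) - \<phi> (u s)) - (norm e)\<^sup>2 / 2 \<le> 0"
    using d by (simp add: e_def[symmetric] d_def[symmetric] power2_norm_eq_inner)
  then show ?thesis by (simp add: e_def[symmetric] d_def[symmetric] algebra_simps)
qed simp

lemma energy_decreasing:
  assumes "0 \<le> s" "s \<le> r"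
  shows "\<phi> (u r) \<le> \<phi> (u s)"
  using flow_decreasing[OF assms, of 0 0 1] by simp

lemma energy_drop:
  assumes "0 \<le> s" "s \<le> r" "c \<ge> 0" "\<And>q. s < q \<Longrightarrow> q < r \<Longrightarrow> norm (g (u q)) \<ge> c"
  shows "c\<^sup>2 * (r - s) \<le> \<phi> (u s) - \<phi> (u r)"
  using flow_decreasing[OF assms(1,2), of "c\<^sup>2" 0 1] assms(3,4) by (simp add: power_mono)

lemma mean_velocity:
  assumes "0 \<le> s" "s \<le> r" "\<And>q. s < q \<Longrightarrow> q < r \<Longrightarrow> norm (g (u q) - G) \<le> \<omega>"
  shows "norm (u r - u s + (r - s) *\<^sub>R G) \<le> \<omega> * (r - s)"
proof (cases "s = r")
  case False
  define e where "e = u r - u s + (r - s) *\<^sub>R G"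
  have "inner (u r - u s) e + 0 * (\<phi> (u r) - \<phi> (u s)) + (inner G e - \<omega> * norm e) * (r - s) \<le> 0"
  proof (rule flow_decreasing[OF assms(1,2)])
    fix q assume q: "s < q" "q < r"
    have "\<bar>inner (g (u q) - G) e\<bar> \<le> \<omega> * norm e"
      using Cauchy_Schwarz_ineq2[of "g (u q) - G" e] mult_right_mono[OF assms(3)[OF q], of "norm e"] by simp
    then show "inner G e - \<omega> * norm e \<le> inner (g (u q)) e + 0 * (norm (g (u q)))\<^sup>2"
      by (simp add: inner_diff_left abs_le_iff)
  qed
  then have "inner e e \<le> \<omega> * (r - s) * norm e"
    by (subst e_def) (simp add: inner_add_left algebra_simps)
  then have "norm e * norm e \<le> \<omega> * (r - s) * norm e" by (simp add: power2_norm_eq_inner[symmetric] power2_eq_square)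
  moreover have "norm (g (u ((s + r) / 2)) - G) \<le> \<omega>" using assms(2) False by (intro assms(3)) auto
  then have "\<omega> \<ge> 0" using norm_ge_zero order_trans by blast
  ultimately show ?thesis using assms(2) unfolding e_def[symmetric] by (cases "norm e = 0") auto
qed simp

end

section \<open>The approximating polygon\<close>

context gradient_flow
begin

text \<open>The essential point is the bound for the difference \<open>a = b - \<phi> \<circ> w\<close> at two points that are close in space
  but far apart along the path. Both \<open>b\<close> and \<open>\<phi>\<close> decrease along the vertices and \<open>b\<close> decreases less
  (\<open>energy_dissipation\<close> on each edge), so \<open>a\<close> varies by at most the drop \<open>E\<close> of \<open>\<phi>\<close>. It also varies by at most a small
  multiple \<open>\<eta>\<close> of the elapsed time, because \<open>w\<close> almost solves the flow equation. If the two points are not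
  close, or if the gradient between them is not small so that the flow passes quickly, the second bound is good
  enough; if the gradient is small there, then \<open>E\<close> is small compared with the distance.\<close>

lemma polygon_exists:
  assumes L: "L > 0" and e: "e > 0" and T: "T \<ge> 0"
  shows "\<exists>t K w b v. polygonal_path t K w b v \<and> w 0 = u 0 \<and>
    (\<forall>k<K. \<forall>r. t k \<le> r \<longrightarrow> r \<le> t (Suc k) \<longrightarrow> norm (v k + g (w r)) \<le> L / 64) \<and>
    (\<forall>r s. 0 \<le> r \<longrightarrow> r \<le> t K \<longrightarrow> 0 \<le> s \<longrightarrow> s \<le> t K \<longrightarrow>
      \<bar>(b r - \<phi> (w r)) - (b s - \<phi> (w s))\<bar> \<le> L / 4 * norm (w r - w s)) \<and>
    (T \<le> t K \<or> norm (g (w (t K))) \<le> L / 64) \<and>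
    (\<forall>r. 0 \<le> r \<longrightarrow> r \<le> T \<longrightarrow> norm (w (min r (t K)) - u r) \<le> e)"
proof -
  \<comment> \<open>The extra unit of time decides at the end whether the flow has settled near the last vertex.\<close>
  define T1 where "T1 = T + 1"
  have T1: "T1 \<ge> 1" using T by (simp add: T1_def)
  have "bounded (u ` {0..T1})"
    by (intro compact_imp_bounded compact_continuous_image u_continuous) auto
  then obtain R where R: "\<And>r. 0 \<le> r \<Longrightarrow> r \<le> T1 \<Longrightarrow> norm (u r) \<le> R"
    unfolding bounded_iff by force
  define Q :: "'a set" where "Q = cball 0 R"
  have uQ: "u r \<in> Q" if "0 \<le> r" "r \<le> T1" for r using R that by (simp add: Q_def)
  have Q: "compact Q" "convex Q" by (simp_all add: Q_def)
  have gQ: "continuous_on Q g" by (rule continuous_on_subset[OF g_continuous]) simp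
  have "bounded (g ` Q)" using compact_continuous_image[OF gQ Q(1)] by (rule compact_imp_bounded)
  then obtain M' where M': "\<And>x. x \<in> Q \<Longrightarrow> norm (g x) \<le> M'"
    unfolding bounded_iff by force
  define M where "M = max 1 M'"
  have M: "M \<ge> 1" "\<And>x. x \<in> Q \<Longrightarrow> norm (g x) \<le> M" using M' by (force simp: M_def)+
  have modulus: "\<exists>\<rho>>0. \<forall>x\<in>Q. \<forall>y\<in>Q. norm (y - x) \<le> \<rho> \<longrightarrow> norm (g y - g x) \<le> \<omega>" if pos: "\<omega> > 0" for \<omega>
  proof -
    obtain \<rho> where "\<rho> > 0" "\<And>x y. x \<in> Q \<Longrightarrow> y \<in> Q \<Longrightarrow> dist y x < \<rho> \<Longrightarrow> dist (g y) (g x) < \<omega>"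
      using compact_uniformly_continuous[OF gQ Q(1)] pos by (rule uniformly_continuous_onE) blast
    then show ?thesis by (intro exI[of _ "\<rho> / 2"]) (force simp: dist_norm)
  qed
  have \<phi>_M: "\<bar>\<phi> x - \<phi> y\<bar> \<le> M * norm (x - y)" if "x \<in> Q" "y \<in> Q" for x y
    using gradient_bound[OF grad Q(2) that, of 0 M] M(2) by simp
  have speed: "norm (u r - u s) \<le> M * (r - s)" if "0 \<le> s" "s \<le> r" "r \<le> T1" for r s
    using mean_velocity[of s r 0 M] that M(2) uQ by simp
  \<comment> \<open>A curve that returns has not been far away: this makes the loops cut off by the chain small.\<close>
  have excursion: "(norm (u r - u s))\<^sup>2 \<le> T1 * M * norm (u s - u s')"
    if "0 \<le> s" "s \<le> r" "r \<le> s'" "s' \<le> T1" for s r s'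
  proof -
    have "(norm (u r - u s))\<^sup>2 \<le> (r - s) * (\<phi> (u s) - \<phi> (u r))" using energy_dissipation that by simp
    also have "\<dots> \<le> T1 * (\<phi> (u s) - \<phi> (u s'))"
      using energy_decreasing[of s r] energy_decreasing[of r s'] that by (intro mult_mono) auto
    also have "\<dots> \<le> T1 * (M * norm (u s - u s'))"
      using \<phi>_M[of "u s" "u s'"] uQ that T1 by (intro mult_left_mono) auto
    finally show ?thesis by simp
  qed

  \<comment> \<open>Gradients below \<open>2 c\<close> count as small. The scales \<open>r\<^sub>0\<close> and \<open>\<eta>\<close> depend on \<open>L\<close> and the flow only; the mesh \<open>h\<close> is chosen after them.\<close>
  define c where "c = L / 96"
  have c: "c > 0" using L by (simp add: c_def)
  obtain \<rho>\<^sub>1 where \<rho>\<^sub>1: "\<rho>\<^sub>1 > 0" "\<forall>x\<in>Q. \<forall>y\<in>Q. norm (y - x) \<le> \<rho>\<^sub>1 \<longrightarrow> norm (g y - g x) \<le> c"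
    using modulus[OF c] by blast
  define r\<^sub>0 where "r\<^sub>0 = min \<rho>\<^sub>1 (\<rho>\<^sub>1\<^sup>2 / (T1 * M))"
  have r\<^sub>0: "r\<^sub>0 > 0" using \<rho>\<^sub>1 T1 M by (simp add: r\<^sub>0_def)
  define \<eta> where "\<eta> = min (L / 64) (min (L / 32 * r\<^sub>0 / (M * T1)) (L / 32 * c\<^sup>2 / M\<^sup>2))"
  have \<eta>: "\<eta> > 0" using L r\<^sub>0 c T1 M by (simp add: \<eta>_def)
  have \<eta>_le: "\<eta> \<le> L / 64" "\<eta> * (M * T1) \<le> L / 32 * r\<^sub>0" "\<eta> * M\<^sup>2 \<le> L / 32 * c\<^sup>2"
  proof -
    have "\<eta> \<le> L / 32 * r\<^sub>0 / (M * T1)" "\<eta> \<le> L / 32 * c\<^sup>2 / M\<^sup>2" by (simp_all add: \<eta>_def)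
    then show "\<eta> * (M * T1) \<le> L / 32 * r\<^sub>0" "\<eta> * M\<^sup>2 \<le> L / 32 * c\<^sup>2"
      using T1 M(1) by (simp_all add: pos_le_divide_eq)
  qed (simp add: \<eta>_def)
  define \<omega> where "\<omega> = \<eta> / 2"
  have \<omega>: "\<omega> > 0" using \<eta> by (simp add: \<omega>_def)
  obtain \<rho>\<^sub>2 where \<rho>\<^sub>2: "\<rho>\<^sub>2 > 0" "\<forall>x\<in>Q. \<forall>y\<in>Q. norm (y - x) \<le> \<rho>\<^sub>2 \<longrightarrow> norm (g y - g x) \<le> \<omega>"
    using modulus[OF \<omega>] by blast
  define \<rho> where "\<rho> = min e \<rho>\<^sub>2"
  have \<rho>: "\<rho> > 0" "\<rho> \<le> e" "\<rho> \<le> \<rho>\<^sub>2" using e \<rho>\<^sub>2 by (auto simp: \<rho>_def)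
  have g_\<omega>: "norm (g y - g x) \<le> \<omega>" if "x \<in> Q" "y \<in> Q" "norm (y - x) \<le> \<rho>" for x y
    using \<rho>\<^sub>2(2) that \<rho>(3) by auto
  define h where "h = min (\<rho> / 2) (min ((\<rho> / 2)\<^sup>2 / (T1 * M)) (\<omega>\<^sup>2 / (2 * M)))"
  have h: "h > 0" using \<rho> T1 M \<omega> by (simp add: h_def)
  have h_le: "h \<le> \<rho> / 2" "T1 * M * h \<le> (\<rho> / 2)\<^sup>2" "2 * (M * h) \<le> \<omega>\<^sup>2"
  proof -
    have "h \<le> (\<rho> / 2)\<^sup>2 / (T1 * M)" "h \<le> \<omega>\<^sup>2 / (2 * M)" by (simp_all add: h_def)
    then show "T1 * M * h \<le> (\<rho> / 2)\<^sup>2" "2 * (M * h) \<le> \<omega>\<^sup>2"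
      using T1 M(1) by (simp_all add: pos_le_divide_eq mult.commute mult.left_commute)
    show "h \<le> \<rho> / 2" unfolding h_def by (rule min.cobounded1)
  qed

  have u_cont: "continuous_on {0..T1} u" by (rule u_continuous) auto
  have T1': "T1 \<ge> 0" using T1 by simp
  obtain K t where t0: "t 0 = 0" and t_less: "\<And>k. k < K \<Longrightarrow> t k < t (Suc k)" and tK: "t K \<le> T1"
    and gap: "\<And>k. k < K \<Longrightarrow> norm (u (t (Suc k)) - u (t k)) = h"
    and sep: "\<And>i j. i < j \<Longrightarrow> j \<le> K \<Longrightarrow> norm (u (t j) - u (t i)) \<ge> h"
    and last: "norm (u T1 - u (t K)) \<le> h"
    by (rule last_exit_chain[OF u_cont h T1']) blast
  have t_mono: "t i \<le> t j" if "i \<le> j" "j \<le> K" for i j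
    using that
  proof (induction j rule: dec_induct)
    case (step n) then show ?case using t_less[of n] by simp
  qed simp
  have t_nonneg: "0 \<le> t k" and t_le: "t k \<le> T1" if "k \<le> K" for k
    using t_mono[of 0 k] t_mono[of k K] that t0 tK by auto
  define p where "p k = u (t k)" for k
  define \<Delta> where "\<Delta> k = t (Suc k) - t k" for k
  \<comment> \<open>The values \<open>\<beta>\<close> of the energy at the vertices drop by \<open>\<bar>v\<bar>\<^sup>2 \<Delta>\<close> on each edge.\<close>
  define v where "v k = (1 / \<Delta> k) *\<^sub>R (p (Suc k) - p k)" for k
  define \<beta> where "\<beta> k = \<phi> (u 0) - (\<Sum>i<k. h\<^sup>2 / \<Delta> i)" for k
  have \<Delta>: "\<Delta> k > 0" if "k < K" for k using t_less[OF that] by (simp add: \<Delta>_def)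
  have pQ: "p k \<in> Q" if "k \<le> K" for k using uQ t_nonneg t_le that by (simp add: p_def)
  have p_gap: "norm (p (Suc k) - p k) = h" if "k < K" for k using gap that by (simp add: p_def)
  have p_sep: "norm (p i - p j) \<ge> h" if "i < j" "j \<le> K" for i j
    using sep[OF that] by (simp add: p_def norm_minus_commute)
  have v_norm: "norm (v k) = h / \<Delta> k" if "k < K" for k
    using p_gap[OF that] \<Delta>[OF that] by (simp add: v_def)

  obtain w where w_vertex: "\<And>k. k \<le> K \<Longrightarrow> w (t k) = p k"
    and w_pl: "\<And>k r. k < K \<Longrightarrow> t k \<le> r \<Longrightarrow> r \<le> t (Suc k) \<Longrightarrow> w r = p k + ((r - t k) / \<Delta> k) *\<^sub>R (p (Suc k) - p k)"
    using interpolation_exists[where t = t and K = K and q = p] t_less unfolding \<Delta>_def by metis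
  obtain b :: "real \<Rightarrow> real" where b_vertex: "\<And>k. k \<le> K \<Longrightarrow> b (t k) = \<beta> k"
    and b_pl: "\<And>k r. k < K \<Longrightarrow> t k \<le> r \<Longrightarrow> r \<le> t (Suc k) \<Longrightarrow> b r = \<beta> k + ((r - t k) / \<Delta> k) *\<^sub>R (\<beta> (Suc k) - \<beta> k)"
    using interpolation_exists[where t = t and K = K and q = \<beta>] t_less unfolding \<Delta>_def by metis
  have w_edge: "w r = w (t k) + (r - t k) *\<^sub>R v k" if "k < K" "t k \<le> r" "r \<le> t (Suc k)" for k r
    using w_pl[OF that] w_vertex[of k] that by (simp add: v_def)
  have b_edge: "b r = b (t k) - (r - t k) * (norm (v k))\<^sup>2" if "k < K" "t k \<le> r" "r \<le> t (Suc k)" for k r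
  proof -
    have "(norm (v k))\<^sup>2 = h\<^sup>2 / \<Delta> k / \<Delta> k"
      using v_norm[OF that(1)] by (simp add: power_divide power2_eq_square)
    then show ?thesis using b_pl[OF that] b_vertex[of k] that by (simp add: \<beta>_def)
  qed
  have v_nonzero: "v k \<noteq> 0" if "k < K" for k
    using v_norm[OF that] \<Delta>[OF that] h by auto

  have near_vertex: "norm (u r - p k) \<le> \<rho> / 2" if "k < K" "t k \<le> r" "r \<le> t (Suc k)" for k r
  proof -
    have "(norm (u r - p k))\<^sup>2 \<le> T1 * M * norm (p k - p (Suc k))"
      unfolding p_def using excursion[of "t k" r "t (Suc k)"] that t_nonneg[of k] t_le[of "Suc k"] by simp
    also have "\<dots> \<le> (\<rho> / 2)\<^sup>2" using h_le(2) p_gap[OF that(1)] by (simp add: norm_minus_commute)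
    finally show ?thesis by (rule power2_le_imp_le) (use \<rho> in simp)
  qed
  \<comment> \<open>The velocity of the polygon is the mean of \<open>- g (u q)\<close> over the time interval of the edge.\<close>
  have v_g: "norm (v k + g (p k)) \<le> \<omega>" if k: "k < K" for k
  proof -
    have "norm (u (t (Suc k)) - u (t k) + (t (Suc k) - t k) *\<^sub>R g (p k)) \<le> \<omega> * (t (Suc k) - t k)"
    proof (rule mean_velocity)
      fix q assume q: "t k < q" "q < t (Suc k)"
      then show "norm (g (u q) - g (p k)) \<le> \<omega>"
        using near_vertex[of k q] k \<rho> pQ[of k] t_nonneg[of k] t_le[of "Suc k"] by (intro g_\<omega> uQ) auto
    qed (use k t_nonneg t_less[of k] in auto)
    moreover have "u (t (Suc k)) - u (t k) + (t (Suc k) - t k) *\<^sub>R g (p k) = \<Delta> k *\<^sub>R (v k + g (p k))"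
      using \<Delta>[OF k] by (simp add: v_def p_def \<Delta>_def scaleR_add_right)
    ultimately have "\<Delta> k * norm (v k + g (p k)) \<le> \<Delta> k * \<omega>"
      using \<Delta>[OF k] by (simp add: \<Delta>_def[symmetric] mult.commute)
    then show ?thesis using \<Delta>[OF k] by simp
  qed
  have v_\<eta>: "norm (g z - (- v k)) \<le> \<eta>" if "k < K" "z \<in> Q \<inter> cball (p k) \<rho>" for k z
  proof -
    have "norm (g z - g (p k)) \<le> \<omega>"
      using that pQ[of k] by (intro g_\<omega>) (auto simp: dist_norm norm_minus_commute)
    then show ?thesis
      using v_g[OF that(1)] norm_triangle_ineq[of "g z - g (p k)" "v k + g (p k)"] by (simp add: \<omega>_def)
  qed
  have w_in: "w r \<in> Q \<inter> cball (p k) \<rho>" and w_u: "norm (w r - u r) \<le> \<rho>"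
    if k: "k < K" and r: "t k \<le> r" "r \<le> t (Suc k)" for k r
  proof -
    define \<mu> where "\<mu> = (r - t k) / \<Delta> k"
    have \<mu>: "0 \<le> \<mu>" "\<mu> \<le> 1" using r \<Delta>[OF k] by (simp_all add: \<mu>_def \<Delta>_def)
    have w: "w r = p k + \<mu> *\<^sub>R (p (Suc k) - p k)" using w_pl[OF k r] by (simp add: \<mu>_def)
    also have "\<dots> = (1 - \<mu>) *\<^sub>R p k + \<mu> *\<^sub>R p (Suc k)" by (simp add: algebra_simps)
    also have "\<dots> \<in> Q" using \<mu> pQ k by (intro convexD[OF Q(2)]) auto
    finally have "w r \<in> Q" .
    moreover have "norm (w r - p k) \<le> 1 * h"
      unfolding w using \<mu> p_gap[OF k] h by (simp add: mult_left_le_one_le)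
    ultimately show "w r \<in> Q \<inter> cball (p k) \<rho>" "norm (w r - u r) \<le> \<rho>"
      using h_le(1) \<rho> near_vertex[OF k r] norm_triangle_ineq4[of "w r - p k" "u r - p k"]
      by (auto simp: dist_norm norm_minus_commute)
  qed

  define a where "a r = b r - \<phi> (w r)" for r
  have a_edge: "\<bar>a r - a s\<bar> \<le> \<eta> * norm (w r - w s)"
    if k: "k < K" and r: "t k \<le> r" "r \<le> t (Suc k)" and s: "t k \<le> s" "s \<le> t (Suc k)" for k r s
  proof -
    have "\<bar>\<phi> (w r) - \<phi> (w s) - inner (- v k) (w r - w s)\<bar> \<le> \<eta> * norm (w r - w s)"
      by (rule gradient_bound[OF grad _ w_in[OF k r] w_in[OF k s] v_\<eta>[OF k]])
        (auto intro: convex_Int Q)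
    moreover have "w r - w s = (r - s) *\<^sub>R v k"
      using w_edge[OF k r] w_edge[OF k s] by (simp flip: scaleR_diff_left)
    then have "inner (v k) (w r - w s) = b s - b r"
      using b_edge[OF k r] b_edge[OF k s]
      by (simp only: inner_scaleR_right power2_norm_eq_inner[symmetric]) (simp add: algebra_simps)
    ultimately show ?thesis by (simp add: a_def abs_minus_commute)
  qed

  have a_vertex: "\<bar>a (t i) - a (t j)\<bar> \<le> L / 32 * norm (p i - p j)" if ij: "i \<le> j" "j \<le> K" for i j
  proof -
    define D where "D = norm (p i - p j)"
    define E where "E = \<phi> (p i) - \<phi> (p j)"
    have iK: "i \<le> K" using ij by simp
    have a_p: "a (t k) = \<beta> k - \<phi> (p k)" if "k \<le> K" for k
      using b_vertex w_vertex that by (simp add: a_def)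
    have "0 \<le> \<beta> i - \<beta> j \<and> \<beta> i - \<beta> j \<le> \<phi> (p i) - \<phi> (p j)"
      using ij
    proof (induction j rule: dec_induct)
      case (step n)
      have "h\<^sup>2 \<le> \<Delta> n * (\<phi> (p n) - \<phi> (p (Suc n)))"
        using energy_dissipation[of "t n" "t (Suc n)"] gap[of n] step t_less[of n] t_nonneg[of n]
        by (simp add: p_def \<Delta>_def)
      then have "h\<^sup>2 / \<Delta> n \<le> \<phi> (p n) - \<phi> (p (Suc n))"
        using \<Delta>[of n] step by (simp add: divide_le_eq mult.commute)
      moreover have "0 \<le> h\<^sup>2 / \<Delta> n" using \<Delta>[of n] step by simp
      ultimately show ?case using step by (simp add: \<beta>_def)
    qed simp
    then have a_E: "\<bar>a (t i) - a (t j)\<bar> \<le> E" using a_p[of i] a_p[of j] ij iK by (simp add: E_def)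
    have a_time: "\<bar>a (t i) - a (t j)\<bar> \<le> \<eta> * M * (t j - t i)"
      using ij
    proof (induction j rule: dec_induct)
      case (step n)
      have "\<bar>a (t n) - a (t (Suc n))\<bar> \<le> \<eta> * norm (p (Suc n) - p n)"
        using a_edge[of n "t n" "t (Suc n)"] step t_less[of n] w_vertex by (simp add: norm_minus_commute)
      also have "\<dots> \<le> \<eta> * (M * (t (Suc n) - t n))"
        unfolding p_def using \<eta> step t_less[of n] t_nonneg[of n] t_le[of "Suc n"]
        by (intro mult_left_mono speed) auto
      finally show ?case using step by (simp add: algebra_simps)
    qed simp
    have E_D: "E \<le> M * D" using \<phi>_M[of "p i" "p j"] pQ ij iK by (simp add: E_def D_def)
    have D: "D \<ge> 0" by (simp add: D_def)
    have titj: "0 \<le> t i" "t i \<le> t j" "t j \<le> T1" using ij iK t_nonneg t_mono t_le by auto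
    \<comment> \<open>Points at distance at least \<open>r\<^sub>0\<close>: the total time is bounded and \<open>\<eta>\<close> was chosen small enough.\<close>
    show ?thesis
    proof (cases "D < r\<^sub>0")
      case False
      have "\<eta> * M * (t j - t i) \<le> \<eta> * M * T1"
        using \<eta> M(1) titj by (intro mult_left_mono) auto
      also have "\<dots> \<le> L / 32 * r\<^sub>0" using \<eta>_le(2) by simp
      also have "\<dots> \<le> L / 32 * D" using False L by simp
      finally show ?thesis using a_time by (simp add: D_def)
    next
      case True
      then have "D < \<rho>\<^sub>1" "D < \<rho>\<^sub>1\<^sup>2 / (T1 * M)" by (simp_all add: r\<^sub>0_def)
      moreover have "T1 * M > 0" using T1 M(1) by simp
      ultimately have "D \<le> \<rho>\<^sub>1" "D * (T1 * M) < \<rho>\<^sub>1\<^sup>2" by (simp_all only: pos_less_divide_eq less_imp_le)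
      then have D\<rho>: "D \<le> \<rho>\<^sub>1" "T1 * M * D \<le> \<rho>\<^sub>1\<^sup>2" by (simp_all add: mult.commute)
      show ?thesis
      proof (cases "norm (g (p i)) \<ge> 2 * c")
        \<comment> \<open>No small gradient on the way: the drop of \<open>\<phi>\<close> bounds the elapsed time by a multiple of \<open>D\<close>.\<close>
        case True
        have "c\<^sup>2 * (t j - t i) \<le> \<phi> (u (t i)) - \<phi> (u (t j))"
        proof (rule energy_drop)
          fix q assume q: "t i < q" "q < t j"
          have "(norm (u q - p i))\<^sup>2 \<le> T1 * M * D"
            unfolding p_def D_def using excursion[of "t i" q "t j"] q titj by simp
          from order_trans[OF this D\<rho>(2)] have "norm (u q - p i) \<le> \<rho>\<^sub>1"
            by (rule power2_le_imp_le) (use \<rho>\<^sub>1(1) in simp)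
          then have "norm (g (u q) - g (p i)) \<le> c"
            using \<rho>\<^sub>1(2) uQ[of q] pQ[OF iK] q titj by auto
          then show "c \<le> norm (g (u q))"
            using True norm_triangle_ineq2[of "g (p i)" "g (p i) - g (u q)"] by (simp add: norm_minus_commute)
        qed (use titj c in auto)
        then have "c\<^sup>2 * (t j - t i) \<le> M * D" using E_D by (simp add: E_def p_def)
        then have "\<eta> * M * (c\<^sup>2 * (t j - t i)) \<le> \<eta> * M * (M * D)"
          using \<eta> M(1) by (intro mult_left_mono) auto
        also have "\<dots> = \<eta> * M\<^sup>2 * D" by (simp add: power2_eq_square)
        also have "\<dots> \<le> L / 32 * c\<^sup>2 * D" using \<eta>_le(3) D by (rule mult_right_mono)
        finally have "c\<^sup>2 * (\<eta> * M * (t j - t i)) \<le> c\<^sup>2 * (L / 32 * D)"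
          by (simp add: mult.commute mult.left_commute)
        then have "\<eta> * M * (t j - t i) \<le> L / 32 * D"
            by (rule mult_left_le_imp_le) (use c in simp)
        then show ?thesis using a_time by (simp add: D_def)
      next
        \<comment> \<open>Small gradient on the ball around \<open>p i\<close> that contains both points.\<close>
        case False
        have "\<bar>\<phi> (p i) - \<phi> (p j) - inner 0 (p i - p j)\<bar> \<le> (3 * c) * norm (p i - p j)"
        proof (rule gradient_bound[OF grad, of "Q \<inter> cball (p i) \<rho>\<^sub>1"])
          fix z assume z: "z \<in> Q \<inter> cball (p i) \<rho>\<^sub>1"
          then have "norm (g z - g (p i)) \<le> c"
            using \<rho>\<^sub>1(2) pQ[OF iK] by (auto simp: dist_norm norm_minus_commute)
          then show "norm (g z - 0) \<le> 3 * c"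
            using False norm_triangle_ineq[of "g z - g (p i)" "g (p i)"] by simp
        qed (use D\<rho>(1) \<rho>\<^sub>1(1) pQ ij iK in \<open>auto simp: D_def dist_norm intro: convex_Int Q\<close>)
        then have "\<bar>E\<bar> \<le> L / 32 * D" by (simp add: E_def D_def c_def)
        then have "E \<le> L / 32 * D" by linarith
        then show ?thesis using a_E by (simp add: D_def)
      qed
    qed
  qed

  have apart: "h * ((t (Suc i) - r) / \<Delta> i + (s - t j) / \<Delta> j) \<le> 3 * norm (w r - w s)"
    if "i < j" "j < K" and r: "t i \<le> r" "r \<le> t (Suc i)" and s: "t j \<le> s" "s \<le> t (Suc j)" for i j r s
  proof -
    define \<sigma> \<theta> where "\<sigma> = (t (Suc i) - r) / \<Delta> i" and "\<theta> = (s - t j) / \<Delta> j"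
    have i: "i < K" using that by simp
    have frac: "(r - t i) / \<Delta> i = 1 - \<sigma>" using \<Delta>[OF i] by (simp add: \<sigma>_def \<Delta>_def field_simps)
    then have wr: "w r = p (Suc i) + \<sigma> *\<^sub>R (p i - p (Suc i))"
      using w_pl[OF i r] unfolding frac by (simp add: algebra_simps)
    have ws: "w s = p j + \<theta> *\<^sub>R (p (Suc j) - p j)" using w_pl[OF \<open>j < K\<close> s] by (simp add: \<theta>_def)
    have bounds: "0 \<le> \<sigma>" "\<sigma> \<le> 1" "0 \<le> \<theta>" "\<theta> \<le> 1"
      using r s \<Delta>[OF i] \<Delta>[OF \<open>j < K\<close>] by (simp_all add: \<sigma>_def \<theta>_def) (simp_all add: \<Delta>_def)
    show ?thesis unfolding wr ws \<sigma>_def[symmetric] \<theta>_def[symmetric]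
    proof (rule segments_apart)
      show "p (Suc i) = p j \<or> h \<le> norm (p (Suc i) - p j)"
        using p_sep[of "Suc i" j] that by (cases "Suc i = j") auto
    qed (use bounds h p_gap p_sep that in \<open>auto simp: norm_minus_commute\<close>)
  qed
  have edge: "\<exists>k<K. t k \<le> r \<and> r \<le> t (Suc k)" if "0 \<le> r" "r \<le> t K" "0 < K" for r
  proof -
    have "r \<le> t j \<Longrightarrow> 0 < j \<Longrightarrow> j \<le> K \<Longrightarrow> \<exists>k<j. t k \<le> r \<and> r \<le> t (Suc k)" for j
    proof (induction j)
      case (Suc j)
      then show ?case using that t0 by (cases "0 < j \<and> r \<le> t j") (auto intro: less_SucI)
    qed simp
    then show ?thesis using that by simp
  qed

  \<comment> \<open>Between different edges, go along the path to the next vertex and from the last vertex on.\<close>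
  have a_cross: "\<bar>a r - a s\<bar> \<le> L / 4 * norm (w r - w s)"
    if ij: "i < j" "j < K" and r: "t i \<le> r" "r \<le> t (Suc i)" and s: "t j \<le> s" "s \<le> t (Suc j)" for i j r s
  proof -
    define d where "d = norm (w r - w s)"
    have i: "i < K" using ij by simp
    have "norm (w r - p (Suc i)) = h * ((t (Suc i) - r) / \<Delta> i)"
    proof -
      have "w (t (Suc i)) - w r = (t (Suc i) - r) *\<^sub>R v i"
        using w_edge[OF i r] w_edge[OF i, of "t (Suc i)"] t_less[OF i] by (simp flip: scaleR_diff_left)
      then show ?thesis using w_vertex[of "Suc i"] i r v_norm[OF i]
        by (simp add: norm_minus_commute[of "w r"])
    qed
    moreover have "norm (p j - w s) = h * ((s - t j) / \<Delta> j)"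
      using w_edge[OF ij(2) s] w_vertex[of j] ij s v_norm[OF ij(2)] by (simp add: norm_minus_commute[of "p j"])
    ultimately have sum: "norm (w r - p (Suc i)) + norm (p j - w s) \<le> 3 * d"
      using apart[OF ij r s] by (simp add: d_def distrib_left)
    have "norm (p (Suc i) - p j) \<le> norm (w r - p (Suc i)) + d + norm (p j - w s)"
    proof -
      have eq: "(w r - w s) - (w r - p (Suc i)) - (p j - w s) = p (Suc i) - p j" by simp
      show ?thesis
        using norm_triangle_ineq4[of "w r - w s" "w r - p (Suc i)"]
          norm_triangle_ineq4[of "(w r - w s) - (w r - p (Suc i))" "p j - w s"]
        unfolding eq d_def by linarith
    qed
    then have "norm (p (Suc i) - p j) \<le> 4 * d" using sum by simp
    then have "L / 32 * norm (p (Suc i) - p j) \<le> L / 32 * (4 * d)"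
      using L by (intro mult_left_mono) auto
    then have mid: "\<bar>a (t (Suc i)) - a (t j)\<bar> \<le> L / 8 * d"
      using a_vertex[OF Suc_leI[OF ij(1)] less_imp_le[OF ij(2)]] by linarith
    have "\<bar>a r - a (t (Suc i))\<bar> \<le> \<eta> * norm (w r - p (Suc i))"
      using a_edge[OF i r, of "t (Suc i)"] t_less[OF i] w_vertex[of "Suc i"] i by simp
    moreover have "\<bar>a (t j) - a s\<bar> \<le> \<eta> * norm (p j - w s)"
      using a_edge[OF ij(2) _ _ s, of "t j"] t_less[OF ij(2)] w_vertex[of j] ij by simp
    ultimately have "\<bar>a r - a (t (Suc i))\<bar> + \<bar>a (t j) - a s\<bar> \<le> \<eta> * (norm (w r - p (Suc i)) + norm (p j - w s))"
      by (simp add: distrib_left)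
    also have "\<dots> \<le> L / 64 * (3 * d)" using sum \<eta>_le(1) \<eta> L by (intro mult_mono) auto
    also have "\<dots> \<le> L / 8 * d" using L by (simp add: d_def)
    finally show ?thesis using mid unfolding d_def[symmetric] by linarith
  qed
  have a_Lip: "\<bar>a r - a s\<bar> \<le> L / 4 * norm (w r - w s)"
    if r: "0 \<le> r" "r \<le> t K" and s: "0 \<le> s" "s \<le> t K" for r s
  proof (cases "K = 0")
    case True then show ?thesis using that t0 by simp
  next
    case False
    obtain i where i: "i < K" "t i \<le> r" "r \<le> t (Suc i)" using edge[OF r] False by auto
    obtain j where j: "j < K" "t j \<le> s" "s \<le> t (Suc j)" using edge[OF s] False by auto
    consider "i = j" | "i < j" | "j < i" by linarith
    then show ?thesis
    proof cases
      case 1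
      then have "\<bar>a r - a s\<bar> \<le> \<eta> * norm (w r - w s)" using a_edge[OF i] j by simp
      also have "\<dots> \<le> L / 4 * norm (w r - w s)" using \<eta>_le(1) L by (intro mult_right_mono) auto
      finally show ?thesis .
    next
      case 2 then show ?thesis using a_cross i j by blast
    next
      case 3 then show ?thesis using a_cross[of j i s r] i j by (simp add: abs_minus_commute norm_minus_commute)
    qed
  qed

  have w_cross: "r = s" if ij: "i < j" "j < K" and r: "t i \<le> r" "r \<le> t (Suc i)"
    and s: "t j \<le> s" "s \<le> t (Suc j)" and eq: "w r = w s" for i j r s
  proof -
    have i: "i < K" using ij by simp
    have "h * ((t (Suc i) - r) / \<Delta> i + (s - t j) / \<Delta> j) \<le> 0" using apart[OF ij r s] eq by simp
    then have "(t (Suc i) - r) / \<Delta> i + (s - t j) / \<Delta> j \<le> 0" using h by (simp add: mult_le_0_iff)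
    moreover have "0 \<le> (t (Suc i) - r) / \<Delta> i" "0 \<le> (s - t j) / \<Delta> j"
      using \<Delta>[OF i] \<Delta>[OF ij(2)] r s by simp_all
    ultimately have "(t (Suc i) - r) / \<Delta> i = 0" "(s - t j) / \<Delta> j = 0" by linarith+
    then have rs: "r = t (Suc i)" "s = t j" using \<Delta>[OF i] \<Delta>[OF ij(2)] by auto
    then have "p (Suc i) = p j" using eq w_vertex i ij by simp
    then have "Suc i = j" using p_sep[of "Suc i" j] ij h by (cases "Suc i = j") auto
    then show ?thesis using rs by simp
  qed
  have w_inj: "inj_on w {0..t K}"
  proof (rule inj_onI)
    fix r s assume rs: "r \<in> {0..t K}" "s \<in> {0..t K}" and eq: "w r = w s"
    show "r = s"
    proof (cases "K = 0")
      case True then show ?thesis using rs t0 by simp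
    next
      case False
      obtain i where i: "i < K" "t i \<le> r" "r \<le> t (Suc i)" using edge[of r] rs False by auto
      obtain j where j: "j < K" "t j \<le> s" "s \<le> t (Suc j)" using edge[of s] rs False by auto
      consider "i = j" | "i < j" | "j < i" by linarith
      then show ?thesis
      proof cases
        case 1
        then have "(r - t i) *\<^sub>R v i = (s - t i) *\<^sub>R v i" using w_edge[OF i] w_edge[of i s] i j eq by auto
        then show ?thesis using v_nonzero[OF i(1)] by simp
      next
        case 2 then show ?thesis using w_cross i j eq by blast
      next
        case 3 then show ?thesis using w_cross[of j i s r] i j eq by simp
      qed
    qed
  qed
  have "polygonal_path t K w b v"
    by (rule polygonal_path.intro) (fact t0 t_less w_edge b_edge v_nonzero w_inj)+
  moreover have "w 0 = u 0" using w_vertex[of 0] t0 by (simp add: p_def)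
  moreover have "norm (v k + g (w r)) \<le> L / 64" if "k < K" "t k \<le> r" "r \<le> t (Suc k)" for k r
    using v_\<eta>[OF that(1) w_in[OF that]] \<eta>_le(1) by (simp add: add.commute)
  moreover have near_end: "norm (u r - p K) \<le> \<rho> / 2" if "t K \<le> r" "r \<le> T1" for r
  proof -
    have "(norm (u r - p K))\<^sup>2 \<le> T1 * M * norm (p K - u T1)"
      unfolding p_def using excursion[of "t K" r T1] that t_nonneg[of K] by simp
    also have "\<dots> \<le> T1 * M * h" using last T1 M(1) by (intro mult_left_mono) (auto simp: p_def norm_minus_commute)
    also have "\<dots> \<le> (\<rho> / 2)\<^sup>2" by (rule h_le(2))
    finally show ?thesis by (rule power2_le_imp_le) (use \<rho> in simp)
  qed
  \<comment> \<open>If the chain ends early, the flow stays near its last vertex for at least a unit of time while \<open>\<phi>\<close> hardly drops.\<close>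
  have "T \<le> t K \<or> norm (g (w (t K))) \<le> L / 64"
  proof (rule ccontr)
    assume "\<not> ?thesis"
    then have "t K < T" "norm (g (p K)) > 2 * \<omega>" using w_vertex[of K] \<eta>_le(1) by (auto simp: \<omega>_def)
    have "\<omega>\<^sup>2 * (T1 - t K) \<le> \<phi> (u (t K)) - \<phi> (u T1)"
    proof (rule energy_drop)
      fix q assume q: "t K < q" "q < T1"
      have "norm (g (u q) - g (p K)) \<le> \<omega>"
        using near_end[of q] q pQ[of K] uQ[of q] t_nonneg[of K] \<rho> by (intro g_\<omega>) auto
      then show "\<omega> \<le> norm (g (u q))"
        using \<open>norm (g (p K)) > 2 * \<omega>\<close> norm_triangle_ineq2[of "g (p K)" "g (p K) - g (u q)"]
        by (simp add: norm_minus_commute)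
    qed (use \<omega> t_nonneg[of K] tK in auto)
    moreover have "\<omega>\<^sup>2 * 1 \<le> \<omega>\<^sup>2 * (T1 - t K)" using \<open>t K < T\<close> by (intro mult_left_mono) (auto simp: T1_def)
    moreover have "\<phi> (u (t K)) - \<phi> (u T1) \<le> M * h"
    proof -
      have "\<phi> (u (t K)) - \<phi> (u T1) \<le> M * norm (u (t K) - u T1)"
        using \<phi>_M[of "u (t K)" "u T1"] uQ[of "t K"] uQ[of T1] t_nonneg[of K] tK T1 by simp
      also have "\<dots> \<le> M * h" using last M(1) by (intro mult_left_mono) (auto simp: norm_minus_commute)
      finally show ?thesis .
    qed
    moreover have "M * h > 0" using M(1) h by simp
    ultimately show False using h_le(3) by linarith
  qed
  moreover have "norm (w (min r (t K)) - u r) \<le> e" if r: "0 \<le> r" "r \<le> T" for r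
  proof (cases "t K \<le> r")
    case True
    then show ?thesis using near_end[of r] that w_vertex[of K] \<rho> by (simp add: T1_def norm_minus_commute)
  next
    case False
    then have "0 < K" using t0 that by (cases K) auto
    then obtain k where "k < K" "t k \<le> r" "r \<le> t (Suc k)" using edge[of r] r False by auto
    then show ?thesis using w_u[of k r] \<rho> False by simp
  qed
  ultimately show ?thesis using a_Lip unfolding a_def
    by (intro exI[of _ t] exI[of _ K] exI[of _ w] exI[of _ b] exI[of _ v]) blast
qed

theorem perturbation_exists:
  assumes A: "A \<ge> 0" and lower: "\<And>x. \<phi> x \<ge> - A * (norm x)\<^sup>2 - B" and e: "e > 0"
  shows "\<exists>f. (\<forall>x y. (f y - \<phi> y) - (f x - \<phi> x) \<le> e * norm (y - x)) \<and>
    eventually (\<lambda>\<tau>. D_inf u (discrete_solutions \<tau> f (u 0)) \<le> ereal e) (at_right 0)"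
proof -
  \<comment> \<open>After the time \<open>1 / e\<close> the weight \<open>1 / (1 + t)\<close> in \<open>d_inf\<close> makes every deviation smaller than \<open>e\<close>.\<close>
  define T where "T = 1 / e + 1"
  have T: "T > 0" "1 / (T - 1) \<le> e" using e by (auto simp: T_def add_pos_pos)
  have e4: "e / 4 > 0" and T1: "T + 1 \<ge> 0" using e T by auto
  from polygon_exists[OF e e4 T1] obtain t K w b v where poly: "polygonal_path t K w b v" and w0: "w 0 = u 0"
    and res: "\<forall>k<K. \<forall>r. t k \<le> r \<longrightarrow> r \<le> t (Suc k) \<longrightarrow> norm (v k + g (w r)) \<le> e / 64"
    and lip: "\<forall>r s. 0 \<le> r \<longrightarrow> r \<le> t K \<longrightarrow> 0 \<le> s \<longrightarrow> s \<le> t K \<longrightarrow>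
      \<bar>(b r - \<phi> (w r)) - (b s - \<phi> (w s))\<bar> \<le> e / 4 * norm (w r - w s)"
    and end_or: "T + 1 \<le> t K \<or> norm (g (w (t K))) \<le> e / 64"
    and close: "\<forall>r. 0 \<le> r \<longrightarrow> r \<le> T + 1 \<longrightarrow> norm (w (min r (t K)) - u r) \<le> e / 4"
    by blast
  interpret polygonal_path t K w b v by fact
  interpret driven_path t K w b v \<phi> g e A B
    by unfold_locales (use grad g_continuous e A lower res lip in auto)
  have cont: "continuous_on {0..T} u" by (rule u_continuous) auto
  obtain \<delta> where \<delta>: "\<delta> > 0"
    "\<And>r s. r \<in> {0..T} \<Longrightarrow> s \<in> {0..T} \<Longrightarrow> dist s r < \<delta> \<Longrightarrow> dist (u s) (u r) < e / 4"
    using compact_uniformly_continuous[OF cont compact_Icc] e4 by (rule uniformly_continuous_onE) blast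
  have "eventually (\<lambda>\<tau>. \<tau> \<in> {0<..<min \<delta> 1}) (at_right 0)"
    using \<delta>(1) by (intro eventually_at_right_real) simp
  with discrete_solutions_exist[of "u 0"] discrete_solutions_follow_path[OF e4 end_or]
  have "eventually (\<lambda>\<tau>. D_inf u (discrete_solutions \<tau> f (u 0)) \<le> ereal e) (at_right 0)"
  proof eventually_elim
    case (elim \<tau>)
    have \<tau>: "0 < \<tau>" "\<tau> < \<delta>" "\<tau> < 1" using elim(3) by auto
    show ?case
    proof (rule D_inf_le[OF elim(1)])
      fix U' assume "U' \<in> discrete_solutions \<tau> f (u 0)"
      then obtain U where U: "U \<in> MS \<tau> f (u 0)" and U'0: "U' 0 = u 0"
        and U': "\<And>n t. n \<ge> 1 \<Longrightarrow> t \<in> {(real n - 1) * \<tau> <.. real n * \<tau>} \<Longrightarrow> U' t = U n"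
        unfolding discrete_solutions_def by blast
      show "d_inf u U' \<le> e"
      proof (rule d_inf_le)
        fix r assume r: "0 \<le> r" "r \<le> T - 1"
        show "norm (u r - U' r) \<le> e"
        proof (cases "r = 0")
          case True then show ?thesis using U'0 e by simp
        next
          case False
          define n where "n = nat \<lceil>r / \<tau>\<rceil>"
          have "0 < r / \<tau>" using False r \<tau> by simp
          then have "real n - 1 < r / \<tau>" "r / \<tau> \<le> real n" "n \<ge> 1"
            unfolding n_def by linarith+
          then have n: "n \<ge> 1" "(real n - 1) * \<tau> < r" "r \<le> real n * \<tau>"
            using \<tau> by (simp_all add: pos_less_divide_eq pos_divide_le_eq)
          have nT: "real n * \<tau> \<le> T" using n(2) r(2) \<tau>(3) by (simp add: algebra_simps)
          have "dist (u (real n * \<tau>)) (u r) < e / 4"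
            using n nT r \<tau> by (intro \<delta>(2)) (auto simp: dist_real_def algebra_simps)
          moreover have "norm (w (min (real n * \<tau>) (t K)) - u (real n * \<tau>)) \<le> e / 4"
            using close nT \<tau> by auto
          moreover have "norm (U n - w (min (real n * \<tau>) (t K))) \<le> e / 4"
            using elim(2) U w0 nT by auto
          moreover have "U' r = U n" using U' n by simp
          ultimately show ?thesis
            using norm_triangle_ineq4[of "U n - w (min (real n * \<tau>) (t K))" "u (real n * \<tau>) - w (min (real n * \<tau>) (t K))"]
              norm_triangle_ineq4[of "U n - u (real n * \<tau>)" "u r - u (real n * \<tau>)"] e
            by (simp add: dist_norm norm_minus_commute)
        qed
      qed (use T e in \<open>auto simp: T_def\<close>)
    qed
  qed
  moreover have "(f y - \<phi> y) - (f x - \<phi> x) \<le> e * norm (y - x)" for x y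
    using \<psi>_Lipschitz[of y x] by (simp add: f_def)
  ultimately show ?thesis by blast
qed

end

section \<open>Reverse approximation of gradient flows\<close>

theorem theorem6p4:
  fixes \<phi> :: "'a::euclidean_space \<Rightarrow> real"
    and grad_\<phi> :: "'a \<Rightarrow> 'a"
    and u :: "real \<Rightarrow> 'a"
  assumes grad: "\<And>x. GDERIV \<phi> x :> grad_\<phi> x"
    and C1: "continuous_on UNIV grad_\<phi>"
    and lower_bound: "\<exists>\<tau>\<^sub>s>0. \<exists>\<phi>\<^sub>s::real. \<forall>x. 1 / (2 * \<tau>\<^sub>s) * (norm x)\<^sup>2 + \<phi> x \<ge> - \<phi>\<^sub>s"
    and flow: "\<And>t. t \<ge> 0 \<Longrightarrow> (u has_vector_derivative - grad_\<phi> (u t)) (at t within {0..})"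
  shows "strongly_approximable \<phi> u \<and>
    (\<exists>\<phi>\<tau> :: real \<Rightarrow> 'a \<Rightarrow> real.
       ((\<lambda>\<tau>. Lip (\<lambda>x. \<phi>\<tau> \<tau> x - \<phi> x)) \<longlongrightarrow> 0) (at_right 0) \<and>
       MM \<phi>\<tau> (u 0) = {restrict u {0..}} \<and>
       GMM \<phi>\<tau> (u 0) = {restrict u {0..}})"
proof -
  interpret gradient_flow \<phi> grad_\<phi> u
    using grad C1 flow by unfold_locales
  obtain \<tau>\<^sub>s \<phi>\<^sub>s where lb: "\<tau>\<^sub>s > 0" "\<And>x. 1 / (2 * \<tau>\<^sub>s) * (norm x)\<^sup>2 + \<phi> x \<ge> - \<phi>\<^sub>s"
    using lower_bound by blast
  have "\<phi> x \<ge> - (1 / (2 * \<tau>\<^sub>s)) * (norm x)\<^sup>2 - \<phi>\<^sub>s" for x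
    using lb(2)[of x] by simp
  from strongly_approximable_diagonal[OF perturbation_exists[OF _ this]] lb(1)
  obtain \<phi>\<tau> where \<phi>\<tau>: "((\<lambda>\<tau>. Lip (\<lambda>x. \<phi>\<tau> \<tau> x - \<phi> x)) \<longlongrightarrow> 0) (at_right 0)"
    "((\<lambda>\<tau>. D_inf u (discrete_solutions \<tau> (\<phi>\<tau> \<tau>) (u 0))) \<longlongrightarrow> 0) (at_right 0)"
    by auto
  have "at 0 within {0<..<1::real} = at_right 0"
    by (rule at_within_nhd[of _ "{-1<..<1}"]) auto
  then have "strongly_approximable \<phi> u"
    unfolding strongly_approximable_def using \<phi>\<tau>
    by (intro exI[of _ 1] exI[of _ \<phi>\<tau>] conjI) simp_all
  then show ?thesis using \<phi>\<tau> MM_of_D_inf[OF \<phi>\<tau>(2)] GMM_of_D_inf[OF \<phi>\<tau>(2)] by blast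
qed

end
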